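(* Let $(\mathbf S,\mathbf M)$ be an unpunctured marked non-orientable surface with a triangulation $T$ and let $\mathcal L_T$ be a principal lamination for $T$. Suppose $\alpha$ is a one-sided closed curve in $\mathbf S$ which is not contractible and has no contractible kinks. Then $$\chi_{\alpha,\mathcal L_T}=\frac{1}{\operatorname{cross}_T(\alpha)}\sum_P x(P)\,y_{\mathcal L_T}(P),$$ where the sum is over all good matchings $P$ of the band graph $\widetilde{\mathcal G}_{T,\alpha}$.
   Context: **Surfaces.** $\mathbf S$ is a compact connected surface with boundary, $\mathbf M\subset\partial\mathbf S$ a finite set of marked points meeting every boundary component. An arc is a simple curve (up to isotopy) with endpoints in $\mathbf M$, otherwise disjoint from $\mathbf M\cup\partial\mathbf S$, not cutting out a monogon or bigon. A triangulation $T$ is a maximal collection of pairwise non-crossing arcs (with no one-sided closed curve). Each arc or boundary segment $\tau$ has a variable $x_\tau$, and each arc $\tau\in T$ a variable $y_\tau$. A closed curve is one-sided if it has no orientable regular neighbourhood. Curves are considered up to isotopy and are drawn with the minimal number of crossings with $T$. If $\alpha$ crosses the arcs $\tau_{i_1},\dots,\tau_{i_d}$ of $T$ (with multiplicity), $\operatorname{cross}_T(\alpha)=x_{i_1}\cdots x_{i_d}$, where $x_{i_j}=x_{\tau_{i_j}}$, $y_{i_j}=y_{\tau_{i_j}}$. **Principal laminations and signs.** For each $\tau\in T$, $L_\tau$ is a lamination associated to $\tau$: a non-self-intersecting curve running along $\tau$ in a small neighbourhood which at both ends turns clockwise (or at both ends counterclockwise, directions being transported along $\tau$) and ends on the boundary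 near the endpoint of $\tau$; when this would self-intersect, it is the corresponding one-sided closed curve instead. There are two choices for each $\tau$; a principal lamination is a choice $\mathcal L_T=\{L_\tau:\tau\in T\}$. Points of the orientable double cover of $\mathbf S$ are pairs (point of $\mathbf S$, local orientation there). For a lift $\tau'$ of $\tau$, let $b_T(\mathcal L_T,\tau')$ be the shear coordinate at $\tau'$ of the preimage of $L_\tau$, i.e. the number of $S$-intersections minus the number of $Z$-intersections with the quadrilateral of the lifted triangulation having $\tau'$ as diagonal. (A directed segment crossing a side, then $\tau'$, then the opposite side is an $S$-intersection if the common endpoint of the first side and $\tau'$ lies to its right and the common endpoint of $\tau'$ and the last side lies to its left; a $Z$-intersection with left and right exchanged.) One has $b_T(\mathcal L_T,\tau')\in\{1,-1\}$, and the two lifts of $\tau$ have opposite signs. For a point of $\tau$ with a local orientation, $b_T(\mathcal L_T,\tau)$ denotes the sign of the corresponding lift. **Elementary steps.** Around each $m\in\mathbf M$ draw a small arc $h_m$ (horocycle) in $\mathbf S$, all disjoint, and fix a local orientation $o_m$ near $m$ (as given by a planar drawing of $\mathbf S$ with crosscaps). For an end at $m$ of an arc or boundary segment $\tau$ of $T$, $v_{m,\tau}=h_m\cap\tau$, and $v^{+}_{m,\tau}$, $v^-_{m,\tau}$ are points of $h_m$ just clockwise, resp. counterclockwise, of $v_{m,\tau}$ (w.r.t. $o_m$). - Type 1: move along $h_m$ inside the corner at $m$ of a triangle of $T$, from $\tau$ to $\tau'$, where $\sigma$ is the third side of the triangle; matrix $\begin{bmatrix}1&0\\ \pm\frac{x_\sigma}{x_\tau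 x_{\tau'}}&1\end{bmatrix}$, sign $+$ if clockwise and $-$ otherwise. - Type 2: cross $\tau\in T$ along $h_m$. With $b=b_T(\mathcal L_T,\tau)$ at the point $v_{m,\tau}$ with orientation $o_m$: the matrix is $\operatorname{diag}(1,y_\tau)$ if (clockwise and $b=1$) or (counterclockwise and $b=-1$), and $\operatorname{diag}(y_\tau,1)$ otherwise. - Type 3: follow a path parallel to $\tau$ from a point near one end, at $m$, to a point near its other end, at $m'$, not crossing $\tau$, when transport along $\tau$ carries $o_m$ to $o_{m'}$ (so the path goes from $v^\pm_{m,\tau}$ to $v^\mp_{m',\tau}$); matrix $\begin{bmatrix}0&x_\tau\\-\frac1{x_\tau}&0\end{bmatrix}$ if $\tau$ is seen on the right at the start, and $\begin{bmatrix}0&-x_\tau\\ \frac1{x_\tau}&0\end{bmatrix}$ otherwise. - Type $3'$: the same when transport along $\tau$ reverses orientation, i.e. the path goes through the crosscap, from $v^{\pm}_{m,\tau}$ to $v^{\pm}_{m',\tau}$; matrix $\begin{bmatrix}0&x_\tau\\ \frac1{x_\tau}&0\end{bmatrix}$ if $\tau$ is seen on the right at the start and $\begin{bmatrix}0&-x_\tau\\-\frac1{x_\tau}&0\end{bmatrix}$ otherwise. **$M$-paths and $\chi$.** An $M$-path for $\alpha$ is a closed path $\rho$ that is a concatenation of elementary steps $\rho_1,\dots,\rho_t$ (in this order), is isotopic to $\alpha$, and whose intersections with $T$ are in bijection with those of $\alpha$. Put $M(\rho)=M(\rho_t)\cdots M(\rho_1)$ and $\chi_{\alpha,\mathcal L_T}=|\operatorname{tr}M(\rho)|$,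 which does not depend on the choice of $\rho$; here $|f|$ is whichever of $f,-f$ has positive coefficients. **Band graph $\widetilde{\mathcal G}_{T,\alpha}$.** Choose a triangle $\Delta$ of $T$ and a point $p$ of $\alpha$ in $\Delta$. Traverse $\alpha$ from $p$, crossing $\tau_{i_1},\dots,\tau_{i_d}$ in order and returning to $p$; let $a$ be the third side of $\Delta$ (besides $\tau_{i_d},\tau_{i_1}$), and choose the local orientation at $p$ at the start so that the clockwise order of the sides of $\Delta$ is $\tau_{i_d},\tau_{i_1},a$ (so that on returning to $\Delta$ with the transported, reversed orientation, $\tau_{i_1}$ is the side of $\Delta$ next counterclockwise from $\tau_{i_d}$). Transport the orientation along $\alpha$. Let $\epsilon_j=b_T(\mathcal L_T,\tau_{i_j})$ be the sign at the $j$-th crossing with the transported orientation. For $1\le j\le d-1$, let $a_j$ be the third side of the triangle crossed between $\tau_{i_j}$ and $\tau_{i_{j+1}}$; call the transition CCW if the clockwise order of its sides (transported orientation) is $\tau_{i_j},a_j,\tau_{i_{j+1}}$ and CW otherwise. Take unit square tiles $G_1,\dots,G_d$, with the NW–SE diagonal of $G_j$ labelled $i_j$ (diagonals are not edges of the graph). $G_{j+1}$ is glued above $G_j$ if ($j$ odd and CCW) or ($j$ even and CW); then the common edge is labelled $a_j$, the East edge of $G_j$ is $i_{j+1}$ and the West edge of $G_{j+1}$ is $i_j$. Otherwise $G_{j+1}$ is glued to the right of $G_j$; then the common edge is $a_j$, the North edge of $G_j$ is $i_{j+1}$ and the South edge of $G_{j+1}$ is $i_j$. The South and West edges of $G_1$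 are labelled $a$ and $i_d$. The North and East edges of $G_d$ are labelled $a'$ and $i_1$ respectively if $d$ is odd, and $i_1$ and $a'$ respectively if $d$ is even. The band graph is obtained by identifying $a$ with $a'$ (the SE corner of $G_1$ with the NE corner of $G_d$); $x_{a'}=x_a$. **Good matchings and weights.** The good matchings are obtained, each exactly once, from the perfect matchings $P$ of the snake graph (before identification) that contain at least one of the edges $a,a'$, by deleting one of these two; $x(P)$ is the product of $x_e$ over the labels $e$ of the remaining edges. The matching $P$ of the snake graph orients the diagonals: there is a unique path from the SW corner of $G_1$ to the NE corner of $G_d$ alternating between edges of $P$ and diagonals; a diagonal is oriented up if traversed from SE to NW and down otherwise. The diagonal of $G_j$ is $\mathcal L_T$-oriented if $j$ is odd and ($\epsilon_j=1$, down) or ($\epsilon_j=-1$, up), or if $j$ is even and ($\epsilon_j=1$, up) or ($\epsilon_j=-1$, down). Then $y_{\mathcal L_T}(P)=\prod y_{i_j}$ over the $j$ with $\mathcal L_T$-oriented diagonal. *)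

theory Defs
  imports "HOL-Analysis.Analysis" "HOL-Library.Poly_Mapping"
begin

section \<open>Triangulated marked surfaces\<close>

text \<open>
  A marked surface together with a triangulation \<open>T\<close> is given by its gluing scheme: a finite set of
  triangles whose sides are labelled by the arcs of \<open>T\<close> and the boundary segments.  An element of
  \<open>sides\<close> is one side of one triangle.  Every triangle carries an arbitrary reference orientation,
  for which \<open>cw s\<close> is the side following \<open>s\<close> in clockwise order, so that the triangles are the
  \<open>cw\<close>-orbits.  A label occurring on two sides is an arc, and these two sides are glued; a
  label occurring on one side only is a boundary segment.  \<open>twisted \<tau>\<close> says that the reference
  orientations of the triangles on the two sides of \<open>\<tau>\<close> disagree along \<open>\<tau>\<close>.
\<close>

record ('s, 'e) triangulation =
  sides :: "'s set"
  cw :: "'s \<Rightarrow> 's"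
  edge :: "'s \<Rightarrow> 'e"
  twisted :: "'e \<Rightarrow> bool"

definition ccw :: "('s, 'e) triangulation \<Rightarrow> 's \<Rightarrow> 's" where
  "ccw T s = cw T (cw T s)"

definition triangle :: "('s, 'e) triangulation \<Rightarrow> 's \<Rightarrow> 's set" where
  "triangle T s = {s, cw T s, ccw T s}"

definition inner :: "('s, 'e) triangulation \<Rightarrow> 's \<Rightarrow> bool" where
  "inner T s \<longleftrightarrow> s \<in> sides T \<and> (\<exists>s'\<in>sides T. s' \<noteq> s \<and> edge T s' = edge T s)"

definition arcs :: "('s, 'e) triangulation \<Rightarrow> 'e set" where
  "arcs T = edge T ` {s. inner T s}"

definition partner :: "('s, 'e) triangulation \<Rightarrow> 's \<Rightarrow> 's" where
  "partner T s = (THE s'. s' \<in> sides T \<and> s' \<noteq> s \<and> edge T s' = edge T s)"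

definition triangulated_surface :: "('s, 'e) triangulation \<Rightarrow> bool" where
  "triangulated_surface T \<longleftrightarrow>
     finite (sides T) \<and> sides T \<noteq> {} \<and>
     (\<forall>s\<in>sides T. cw T s \<in> sides T \<and> cw T s \<noteq> s \<and> cw T (cw T (cw T s)) = s) \<and>
     (\<forall>s\<in>sides T. card {s'\<in>sides T. edge T s' = edge T s} \<le> 2) \<and>
     (\<forall>s\<in>sides T. \<forall>s'\<in>sides T.
        (s, s') \<in> ({(r, cw T r) | r. r \<in> sides T} \<union> {(r, partner T r) | r. inner T r})\<^sup>*)"

definition orientable :: "('s, 'e) triangulation \<Rightarrow> bool" where
  "orientable T \<longleftrightarrow>
     (\<exists>\<omega>. (\<forall>s\<in>sides T. \<omega> (cw T s) = \<omega> s) \<and>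
          (\<forall>s. inner T s \<longrightarrow> \<omega> (partner T s) = (\<omega> s \<noteq> twisted T (edge T s))))"

text \<open>
  A flag \<open>(s, e)\<close> is an end of the side \<open>s\<close>, seen from within the triangle of \<open>s\<close>: the end shared with
  \<open>cw s\<close> if \<open>e\<close> holds, the end shared with \<open>ccw s\<close> otherwise.  It stands for the point of the horocycle
  at this marked point which lies in the triangle of \<open>s\<close>, next to \<open>s\<close>; so flags are the points
  \<open>v\<^sup>+\<close>, \<open>v\<^sup>-\<close> between which the elementary steps run: within the corner of the triangle, across
  the arc, and along the side to its other end.
\<close>

type_synonym 's flag = "'s \<times> bool"

fun corner_move :: "('s, 'e) triangulation \<Rightarrow> 's flag \<Rightarrow> 's flag" where
  "corner_move T (s, e) = (if e then (cw T s, False) else (ccw T s, True))"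

text \<open>
  When the orientations agree across an arc, its two sides are traversed in opposite directions by
  the clockwise boundary cycles of the two triangles.
\<close>

fun cross_move :: "('s, 'e) triangulation \<Rightarrow> 's flag \<Rightarrow> 's flag" where
  "cross_move T (s, e) = (partner T s, if twisted T (edge T s) then e else \<not> e)"

fun along_move :: "'s flag \<Rightarrow> 's flag" where
  "along_move (s, e) = (s, \<not> e)"

text \<open>Every marked point lies on the boundary: turning around it leads to a boundary segment.\<close>

definition unpunctured :: "('s, 'e) triangulation \<Rightarrow> bool" where
  "unpunctured T \<longleftrightarrow>
     (\<forall>s\<in>sides T. \<forall>e. \<exists>n. \<not> inner T (fst (((corner_move T \<circ> cross_move T) ^^ n) (s, e))))"

text \<open>
  The local orientations \<open>o\<^sub>m\<close> near the marked points \<open>m\<close>: for each flag \<open>(s, e)\<close> at \<open>m\<close>, whether \<open>o\<^sub>m\<close>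
  agrees there with the reference orientation of the triangle of \<open>s\<close>.
\<close>

definition point_orientations :: "('s, 'e) triangulation \<Rightarrow> ('s flag \<Rightarrow> bool) \<Rightarrow> bool" where
  "point_orientations T om \<longleftrightarrow>
     (\<forall>s\<in>sides T. \<forall>e. om (corner_move T (s, e)) = om (s, e)) \<and>
     (\<forall>s. inner T s \<longrightarrow> (\<forall>e. om (cross_move T (s, e)) = (om (s, e) \<noteq> twisted T (edge T s))))"


section \<open>Closed curves\<close>

text \<open>
  A directed closed curve is recorded by the cyclic sequence of its intersections with \<open>T\<close>, each
  intersection by the side through which the curve leaves a triangle.  Since \<open>T\<close> cuts the surface
  into discs, such sequences up to rotation and insertion or deletion of a backtracking
  \<open>s, partner s\<close> are the free homotopy classes of closed curves; the curves drawn with the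
  minimal number of crossings are the sequences of minimal length in their class.
\<close>

definition closed_curve :: "('s, 'e) triangulation \<Rightarrow> 's list \<Rightarrow> bool" where
  "closed_curve T w \<longleftrightarrow>
     (\<forall>s\<in>set w. inner T s) \<and>
     (\<forall>k<length w. w ! (Suc k mod length w) \<in> triangle T (partner T (w ! k)))"

inductive homotopic_curves :: "('s, 'e) triangulation \<Rightarrow> 's list \<Rightarrow> 's list \<Rightarrow> bool" for T where
  refl: "closed_curve T w \<Longrightarrow> homotopic_curves T w w"
| rotate: "closed_curve T (s # w) \<Longrightarrow> homotopic_curves T (s # w) (w @ [s])"
| cancel: "closed_curve T (s # partner T s # w) \<Longrightarrow> homotopic_curves T (s # partner T s # w) w"
| sym: "homotopic_curves T v w \<Longrightarrow> homotopic_curves T w v"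
| trans: "homotopic_curves T u v \<Longrightarrow> homotopic_curves T v w \<Longrightarrow> homotopic_curves T u w"

definition contractible_curve :: "('s, 'e) triangulation \<Rightarrow> 's list \<Rightarrow> bool" where
  "contractible_curve T w \<longleftrightarrow> homotopic_curves T w []"

definition minimal_crossings :: "('s, 'e) triangulation \<Rightarrow> 's list \<Rightarrow> bool" where
  "minimal_crossings T w \<longleftrightarrow> (\<forall>v. homotopic_curves T w v \<longrightarrow> length w \<le> length v)"

text \<open>A kink is a part of the curve which closes up to a loop.\<close>

definition contractible_kink :: "('s, 'e) triangulation \<Rightarrow> 's list \<Rightarrow> bool" where
  "contractible_kink T w \<longleftrightarrow>
     (\<exists>n k. 0 < k \<and> k < length w \<and> closed_curve T (take k (rotate n w)) \<and>
            contractible_curve T (take k (rotate n w)))"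

text \<open>
  Local orientations in a triangle are encoded by their agreement with its reference orientation.
  \<open>transport T w u\<close> is the orientation \<open>u\<close> transported through the crossings \<open>w\<close>.
\<close>

definition transport :: "('s, 'e) triangulation \<Rightarrow> 's list \<Rightarrow> bool \<Rightarrow> bool" where
  "transport T w u = foldl (\<lambda>v s. v \<noteq> twisted T (edge T s)) u w"

definition one_sided :: "('s, 'e) triangulation \<Rightarrow> 's list \<Rightarrow> bool" where
  "one_sided T w \<longleftrightarrow> transport T w True = False"


section \<open>Principal laminations and shear coordinates\<close>

text \<open>
  The orientable double cover is triangulated by the pairs of a triangle and a local orientation.  Its
  sides are pairs \<open>(s, u)\<close>, and the two sides \<open>\<sigma>\<close>, \<open>lift_cross T \<sigma>\<close> form a lift of the arc \<open>edge T s\<close>.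
\<close>

type_synonym 's lift_side = "'s \<times> bool"

fun lift_cw :: "('s, 'e) triangulation \<Rightarrow> 's lift_side \<Rightarrow> 's lift_side" where
  "lift_cw T (s, u) = (if u then cw T s else ccw T s, u)"

fun lift_ccw :: "('s, 'e) triangulation \<Rightarrow> 's lift_side \<Rightarrow> 's lift_side" where
  "lift_ccw T (s, u) = (if u then ccw T s else cw T s, u)"

fun lift_cross :: "('s, 'e) triangulation \<Rightarrow> 's lift_side \<Rightarrow> 's lift_side" where
  "lift_cross T (s, u) = (partner T s, u \<noteq> twisted T (edge T s))"

fun deck :: "'s lift_side \<Rightarrow> 's lift_side" where
  "deck (s, u) = (s, \<not> u)"

text \<open>
  A passage \<open>(\<rho>, \<sigma>)\<close> enters a lifted triangle through \<open>\<rho>\<close> and leaves it through \<open>\<sigma>\<close>.  The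
  common endpoint of \<open>\<rho>\<close> and \<open>\<sigma>\<close> lies to its right iff \<open>\<rho>\<close> is the next side clockwise after \<open>\<sigma>\<close>.
  Two consecutive passages constitute one crossing.
\<close>

type_synonym 's passage = "'s lift_side \<times> 's lift_side"

definition endpoint_right :: "('s, 'e) triangulation \<Rightarrow> 's passage \<Rightarrow> bool" where
  "endpoint_right T p \<longleftrightarrow> fst p = lift_cw T (snd p)"

definition endpoint_left :: "('s, 'e) triangulation \<Rightarrow> 's passage \<Rightarrow> bool" where
  "endpoint_left T p \<longleftrightarrow> snd p = lift_cw T (fst p)"

definition S_intersection :: "('s, 'e) triangulation \<Rightarrow> 's passage \<times> 's passage \<Rightarrow> bool" where
  "S_intersection T c \<longleftrightarrow> endpoint_right T (fst c) \<and> endpoint_left T (snd c)"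

definition Z_intersection :: "('s, 'e) triangulation \<Rightarrow> 's passage \<times> 's passage \<Rightarrow> bool" where
  "Z_intersection T c \<longleftrightarrow> endpoint_left T (fst c) \<and> endpoint_right T (snd c)"

definition open_crossings :: "'s passage list \<Rightarrow> ('s passage \<times> 's passage) list" where
  "open_crossings ps = zip ps (tl ps)"

definition closed_crossings :: "'s passage list \<Rightarrow> ('s passage \<times> 's passage) list" where
  "closed_crossings ps = zip ps (rotate1 ps)"

text \<open>
  \<open>fan_turn\<close> follows a curve that circles clockwise around a marked point, from the side by which it
  leaves one lifted triangle to the side by which it leaves the next one.  \<open>fan_passages T \<sigma> n\<close>
  are the first \<open>n\<close> passages after crossing \<open>\<sigma>\<close>; \<open>fan_length T \<sigma>\<close> is their number until the boundary.
\<close>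

definition fan_turn :: "('s, 'e) triangulation \<Rightarrow> 's lift_side \<Rightarrow> 's lift_side" where
  "fan_turn T \<sigma> = lift_ccw T (lift_cross T \<sigma>)"

definition fan_passages :: "('s, 'e) triangulation \<Rightarrow> 's lift_side \<Rightarrow> nat \<Rightarrow> 's passage list" where
  "fan_passages T \<sigma> n =
     map (\<lambda>k. (lift_cross T ((fan_turn T ^^ k) \<sigma>), (fan_turn T ^^ Suc k) \<sigma>)) [0..<n]"

definition fan_length :: "('s, 'e) triangulation \<Rightarrow> 's lift_side \<Rightarrow> nat" where
  "fan_length T \<sigma> = (LEAST n. \<not> inner T (fst ((fan_turn T ^^ n) \<sigma>)))"

text \<open>
  Let \<open>\<sigma>\<close> be a side of a lift of an arc \<open>\<tau>\<close>.  The following is one lift of the curve which runs along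
  \<open>\<tau>\<close>, crossing it once there, and at both ends turns around the endpoint, clockwise for the
  orientation of \<open>\<sigma>\<close>, until it meets the boundary.  The other lift is its image under \<open>deck\<close>.
\<close>

definition open_lamination :: "('s, 'e) triangulation \<Rightarrow> 's lift_side \<Rightarrow> 's passage list" where
  "open_lamination T \<sigma> =
     rev (map prod.swap (fan_passages T (lift_cross T \<sigma>) (fan_length T (lift_cross T \<sigma>)))) @
     fan_passages T \<sigma> (fan_length T \<sigma>)"

text \<open>
  The curve intersects itself iff its two lifts intersect, i.e. iff the lift above, after crossing \<open>\<sigma>\<close>,
  reaches the other lift of \<open>\<tau>\<close> while turning: \<open>\<tau>\<close> is then a one-sided loop, and the curve turns
  from one end of \<open>\<tau>\<close> to the other.  It is replaced by the one-sided closed curve which closes up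
  when coming back to \<open>\<tau>\<close>; the preimage of the latter is one closed curve, invariant under \<open>deck\<close>.
\<close>

definition self_intersecting :: "('s, 'e) triangulation \<Rightarrow> 's lift_side \<Rightarrow> bool" where
  "self_intersecting T \<sigma> \<longleftrightarrow> (\<exists>k \<le> fan_length T \<sigma>. (fan_turn T ^^ k) \<sigma> = deck \<sigma>)"

definition half_closed_lamination :: "('s, 'e) triangulation \<Rightarrow> 's lift_side \<Rightarrow> 's passage list" where
  "half_closed_lamination T \<sigma> = fan_passages T \<sigma> (LEAST k. (fan_turn T ^^ k) \<sigma> = deck \<sigma>)"

definition closed_lamination :: "('s, 'e) triangulation \<Rightarrow> 's lift_side \<Rightarrow> 's passage list" where
  "closed_lamination T \<sigma> =
     half_closed_lamination T \<sigma> @ map (map_prod deck deck) (half_closed_lamination T \<sigma>)"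

definition lamination_crossings ::
    "('s, 'e) triangulation \<Rightarrow> 's lift_side \<Rightarrow> ('s passage \<times> 's passage) list" where
  "lamination_crossings T \<sigma> =
     (if self_intersecting T \<sigma> then closed_crossings (closed_lamination T \<sigma>)
      else open_crossings (open_lamination T \<sigma>) @
           open_crossings (map (map_prod deck deck) (open_lamination T \<sigma>)))"

text \<open>
  A principal lamination chooses, for each arc \<open>\<tau>\<close>, one of its two local orientations, with
  respect to which \<open>L\<^sub>\<tau>\<close> turns clockwise; it is given by a side over \<open>\<tau>\<close> in the double cover
  (both sides of one lift give the same curve).
\<close>

definition principal_lamination ::
    "('s, 'e) triangulation \<Rightarrow> ('e \<Rightarrow> 's lift_side) \<Rightarrow> bool" where
  "principal_lamination T L \<longleftrightarrow>
     (\<forall>\<tau>\<in>arcs T. fst (L \<tau>) \<in> sides T \<and> edge T (fst (L \<tau>)) = \<tau>)"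

text \<open>The shear coordinate \<open>b\<^sub>T(L, \<tau>')\<close> at the lift \<open>\<tau>'\<close> having \<open>\<sigma>\<close> as a side.\<close>

definition shear :: "('s, 'e) triangulation \<Rightarrow> ('e \<Rightarrow> 's lift_side) \<Rightarrow> 's lift_side \<Rightarrow> int" where
  "shear T L \<sigma> =
     (let cs = filter (\<lambda>c. snd (fst c) \<in> {\<sigma>, lift_cross T \<sigma>})
                 (lamination_crossings T (L (edge T (fst \<sigma>))))
      in int (length (filter (S_intersection T) cs)) - int (length (filter (Z_intersection T) cs)))"


section \<open>M-paths\<close>

text \<open>Laurent polynomials with integer coefficients: finitely supported functions on exponent vectors.\<close>

datatype 'e var = X 'e | Y 'e

type_synonym 'e laurent = "('e var \<Rightarrow>\<^sub>0 int) \<Rightarrow>\<^sub>0 int"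

definition xvar :: "'e \<Rightarrow> 'e laurent" where
  "xvar \<tau> = Poly_Mapping.single (Poly_Mapping.single (X \<tau>) 1) 1"

definition xinv :: "'e \<Rightarrow> 'e laurent" where
  "xinv \<tau> = Poly_Mapping.single (Poly_Mapping.single (X \<tau>) (-1)) 1"

definition yvar :: "'e \<Rightarrow> 'e laurent" where
  "yvar \<tau> = Poly_Mapping.single (Poly_Mapping.single (Y \<tau>) 1) 1"

definition positive_sign :: "'e laurent \<Rightarrow> 'e laurent" where
  "positive_sign f = (THE g. (g = f \<or> g = - f) \<and> (\<forall>m. 0 \<le> Poly_Mapping.lookup g m))"

definition mat2 :: "'a::zero \<Rightarrow> 'a \<Rightarrow> 'a \<Rightarrow> 'a \<Rightarrow> 'a^2^2" where
  "mat2 a b c d = vector [vector [a, b], vector [c, d]]"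

datatype step = Corner | Cross | Along

fun move :: "('s, 'e) triangulation \<Rightarrow> step \<Rightarrow> 's flag \<Rightarrow> 's flag" where
  "move T Corner f = corner_move T f"
| "move T Cross f = cross_move T f"
| "move T Along f = along_move f"

text \<open>
  Turning around the common endpoint of \<open>s\<close> and \<open>cw s\<close> inside their triangle, the direction from \<open>s\<close>
  to \<open>cw s\<close> is counterclockwise for the reference orientation.  Crossing \<open>s\<close> outwards near this
  endpoint is clockwise.  A path inside the triangle from this endpoint along \<open>s\<close> sees \<open>s\<close> on its right.
\<close>

fun clockwise_corner :: "('s flag \<Rightarrow> bool) \<Rightarrow> 's flag \<Rightarrow> bool" where
  "clockwise_corner om (s, e) \<longleftrightarrow> e \<noteq> om (s, e)"

fun clockwise_cross :: "('s flag \<Rightarrow> bool) \<Rightarrow> 's flag \<Rightarrow> bool" where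
  "clockwise_cross om (s, e) \<longleftrightarrow> e = om (s, e)"

fun seen_on_right :: "('s flag \<Rightarrow> bool) \<Rightarrow> 's flag \<Rightarrow> bool" where
  "seen_on_right om (s, e) \<longleftrightarrow> e = om (s, e)"

definition corner_matrix ::
    "('s, 'e) triangulation \<Rightarrow> ('s flag \<Rightarrow> bool) \<Rightarrow> 's flag \<Rightarrow> 'e laurent^2^2" where
  "corner_matrix T om f =
     (let s = fst f;
          s' = (if snd f then cw T s else ccw T s);
          s'' = (if snd f then ccw T s else cw T s);
          q = xvar (edge T s'') * xinv (edge T s) * xinv (edge T s')
      in mat2 1 0 (if clockwise_corner om f then q else - q) 1)"

definition cross_matrix ::
    "('s, 'e) triangulation \<Rightarrow> ('e \<Rightarrow> 's lift_side) \<Rightarrow> ('s flag \<Rightarrow> bool) \<Rightarrow> 's flag \<Rightarrow> 'e laurent^2^2" where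
  "cross_matrix T L om f =
     (let y = yvar (edge T (fst f)); b = shear T L (fst f, om f)
      in if (clockwise_cross om f \<and> b = 1) \<or> (\<not> clockwise_cross om f \<and> b = -1)
         then mat2 1 0 0 y else mat2 y 0 0 1)"

definition along_matrix ::
    "('s, 'e) triangulation \<Rightarrow> ('s flag \<Rightarrow> bool) \<Rightarrow> 's flag \<Rightarrow> 'e laurent^2^2" where
  "along_matrix T om f =
     (let x = xvar (edge T (fst f)); x' = xinv (edge T (fst f))
      in if om (along_move f) = om f
         then (if seen_on_right om f then mat2 0 x (- x') 0 else mat2 0 (- x) x' 0)
         else (if seen_on_right om f then mat2 0 x x' 0 else mat2 0 (- x) (- x') 0))"

fun step_matrix ::
    "('s, 'e) triangulation \<Rightarrow> ('e \<Rightarrow> 's lift_side) \<Rightarrow> ('s flag \<Rightarrow> bool) \<Rightarrow> step \<Rightarrow> 's flag \<Rightarrow> 'e laurent^2^2"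
  where
  "step_matrix T L om Corner f = corner_matrix T om f"
| "step_matrix T L om Cross f = cross_matrix T L om f"
| "step_matrix T L om Along f = along_matrix T om f"

text \<open>Paths are given by their initial flag and the list of their elementary steps.\<close>

primrec path_matrix ::
    "('s, 'e) triangulation \<Rightarrow> ('e \<Rightarrow> 's lift_side) \<Rightarrow> ('s flag \<Rightarrow> bool) \<Rightarrow> 's flag \<Rightarrow> step list \<Rightarrow> 'e laurent^2^2"
  where
  "path_matrix T L om f [] = mat 1"
| "path_matrix T L om f (a # as) = path_matrix T L om (move T a f) as ** step_matrix T L om a f"

primrec path_end :: "('s, 'e) triangulation \<Rightarrow> 's flag \<Rightarrow> step list \<Rightarrow> 's flag" where
  "path_end T f [] = f"
| "path_end T f (a # as) = path_end T (move T a f) as"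

primrec path_valid :: "('s, 'e) triangulation \<Rightarrow> 's flag \<Rightarrow> step list \<Rightarrow> bool" where
  "path_valid T f [] \<longleftrightarrow> fst f \<in> sides T"
| "path_valid T f (a # as) \<longleftrightarrow>
     fst f \<in> sides T \<and> (a = Cross \<longrightarrow> inner T (fst f)) \<and> path_valid T (move T a f) as"

primrec path_crossings :: "('s, 'e) triangulation \<Rightarrow> 's flag \<Rightarrow> step list \<Rightarrow> 's list" where
  "path_crossings T f [] = []"
| "path_crossings T f (a # as) =
     (if a = Cross then [fst f] else []) @ path_crossings T (move T a f) as"

text \<open>
  A closed path is isotopic to the curve \<open>w\<close>, with corresponding intersections with \<open>T\<close>, iff it runs
  through the same cyclic sequence of crossings, in one of the two directions of \<open>w\<close>.
\<close>

definition M_path :: "('s, 'e) triangulation \<Rightarrow> 's list \<Rightarrow> 's flag \<times> step list \<Rightarrow> bool" where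
  "M_path T w \<rho> \<longleftrightarrow>
     path_valid T (fst \<rho>) (snd \<rho>) \<and> path_end T (fst \<rho>) (snd \<rho>) = fst \<rho> \<and>
     (\<exists>n. path_crossings T (fst \<rho>) (snd \<rho>) = rotate n w \<or>
          path_crossings T (fst \<rho>) (snd \<rho>) = rotate n (rev (map (partner T) w)))"

definition chi ::
    "('s, 'e) triangulation \<Rightarrow> ('e \<Rightarrow> 's lift_side) \<Rightarrow> ('s flag \<Rightarrow> bool) \<Rightarrow> 's list \<Rightarrow> 'e laurent" where
  "chi T L om w =
     (THE c. \<exists>\<rho>. M_path T w \<rho> \<and> c = positive_sign (trace (path_matrix T L om (fst \<rho>) (snd \<rho>))))"


section \<open>Snake graphs\<close>

text \<open>
  The tiles \<open>G\<^sub>1, \<dots>, G\<^sub>d\<close> are unit squares of the integer grid; \<open>A j\<close> says that \<open>G\<^sub>j\<^sub>+\<^sub>1\<close> is glued above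
  \<open>G\<^sub>j\<close> rather than to its right.
\<close>

fun tile_pos :: "(nat \<Rightarrow> bool) \<Rightarrow> nat \<Rightarrow> nat \<times> nat" where
  "tile_pos A 0 = (0, 0)"
| "tile_pos A (Suc 0) = (0, 0)"
| "tile_pos A (Suc (Suc j)) =
     (let (x, y) = tile_pos A (Suc j) in if A (Suc j) then (x, Suc y) else (Suc x, y))"

definition SW_corner :: "(nat \<Rightarrow> bool) \<Rightarrow> nat \<Rightarrow> nat \<times> nat" where
  "SW_corner A j = tile_pos A j"

definition SE_corner :: "(nat \<Rightarrow> bool) \<Rightarrow> nat \<Rightarrow> nat \<times> nat" where
  "SE_corner A j = (Suc (fst (tile_pos A j)), snd (tile_pos A j))"

definition NW_corner :: "(nat \<Rightarrow> bool) \<Rightarrow> nat \<Rightarrow> nat \<times> nat" where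
  "NW_corner A j = (fst (tile_pos A j), Suc (snd (tile_pos A j)))"

definition NE_corner :: "(nat \<Rightarrow> bool) \<Rightarrow> nat \<Rightarrow> nat \<times> nat" where
  "NE_corner A j = (Suc (fst (tile_pos A j)), Suc (snd (tile_pos A j)))"

datatype direction = South | West | North | East

type_synonym tile_edge = "nat \<times> direction"

fun edge_ends :: "(nat \<Rightarrow> bool) \<Rightarrow> tile_edge \<Rightarrow> (nat \<times> nat) set" where
  "edge_ends A (j, South) = {SW_corner A j, SE_corner A j}"
| "edge_ends A (j, West) = {SW_corner A j, NW_corner A j}"
| "edge_ends A (j, North) = {NW_corner A j, NE_corner A j}"
| "edge_ends A (j, East) = {SE_corner A j, NE_corner A j}"

text \<open>The common edge of \<open>G\<^sub>j\<close> and \<open>G\<^sub>j\<^sub>+\<^sub>1\<close> is listed only once, as an edge of \<open>G\<^sub>j\<close>.\<close>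

definition snake_edges :: "nat \<Rightarrow> (nat \<Rightarrow> bool) \<Rightarrow> tile_edge set" where
  "snake_edges d A =
     {(1, South), (1, West)} \<union> {(j, D) | j D. j \<in> {1..d} \<and> D \<in> {North, East}} \<union>
     {(Suc j, if A j then West else South) | j. j \<in> {1..<d}}"

definition snake_vertices :: "nat \<Rightarrow> (nat \<Rightarrow> bool) \<Rightarrow> (nat \<times> nat) set" where
  "snake_vertices d A = (\<Union>e\<in>snake_edges d A. edge_ends A e)"

definition perfect_matching :: "nat \<Rightarrow> (nat \<Rightarrow> bool) \<Rightarrow> tile_edge set \<Rightarrow> bool" where
  "perfect_matching d A P \<longleftrightarrow>
     P \<subseteq> snake_edges d A \<and> (\<forall>v\<in>snake_vertices d A. \<exists>!e. e \<in> P \<and> v \<in> edge_ends A e)"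

text \<open>
  The path from the SW corner of \<open>G\<^sub>1\<close> to the NE corner of \<open>G\<^sub>d\<close> alternating between edges of \<open>P\<close> and
  diagonals, as its list of vertices.  No diagonal contains either of these two corners, so the first
  and the last step are edges of \<open>P\<close>.
\<close>

definition alternating_path ::
    "nat \<Rightarrow> (nat \<Rightarrow> bool) \<Rightarrow> tile_edge set \<Rightarrow> (nat \<times> nat) list \<Rightarrow> bool" where
  "alternating_path d A P vs \<longleftrightarrow>
     vs \<noteq> [] \<and> even (length vs) \<and> hd vs = SW_corner A 1 \<and> last vs = NE_corner A d \<and>
     (\<forall>k. Suc k < length vs \<longrightarrow>
        (if even k then \<exists>e\<in>P. {vs ! k, vs ! Suc k} = edge_ends A e
         else \<exists>j\<in>{1..d}. {vs ! k, vs ! Suc k} = {NW_corner A j, SE_corner A j}))"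

definition diagonal_up :: "nat \<Rightarrow> (nat \<Rightarrow> bool) \<Rightarrow> tile_edge set \<Rightarrow> nat \<Rightarrow> bool" where
  "diagonal_up d A P j \<longleftrightarrow>
     (\<exists>vs k. alternating_path d A P vs \<and> odd k \<and> Suc k < length vs \<and>
             vs ! k = SE_corner A j \<and> vs ! Suc k = NW_corner A j)"


section \<open>The band graph of a one-sided closed curve\<close>

text \<open>
  The base point and the direction of the curve are those of the list \<open>w\<close>; crossings are numbered from
  \<open>1\<close> to \<open>d = length w\<close>.
\<close>

definition crossing :: "'s list \<Rightarrow> nat \<Rightarrow> 's" where
  "crossing w j = w ! (j - 1)"

definition crossed_arc :: "('s, 'e) triangulation \<Rightarrow> 's list \<Rightarrow> nat \<Rightarrow> 'e" where
  "crossed_arc T w j = edge T (crossing w j)"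

definition third_side :: "('s, 'e) triangulation \<Rightarrow> 's \<Rightarrow> 's \<Rightarrow> 's" where
  "third_side T p q = (THE r. triangle T p = {p, q, r})"

definition cut_edge :: "('s, 'e) triangulation \<Rightarrow> 's list \<Rightarrow> 'e" where
  "cut_edge T w = edge T (third_side T (partner T (crossing w (length w))) (crossing w 1))"

definition passed_edge :: "('s, 'e) triangulation \<Rightarrow> 's list \<Rightarrow> nat \<Rightarrow> 'e" where
  "passed_edge T w j = edge T (third_side T (partner T (crossing w j)) (crossing w (Suc j)))"

text \<open>
  The starting orientation is the one for which \<open>\<tau>\<^sub>i\<^sub>1\<close> follows \<open>\<tau>\<^sub>i\<^sub>d\<close> clockwise in the initial triangle.
\<close>

definition curve_orientation :: "('s, 'e) triangulation \<Rightarrow> 's list \<Rightarrow> nat \<Rightarrow> bool" where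
  "curve_orientation T w j =
     transport T (take (j - 1) w) (crossing w 1 = cw T (partner T (crossing w (length w))))"

definition crossing_sign ::
    "('s, 'e) triangulation \<Rightarrow> ('e \<Rightarrow> 's lift_side) \<Rightarrow> 's list \<Rightarrow> nat \<Rightarrow> int" where
  "crossing_sign T L w j = shear T L (crossing w j, curve_orientation T w j)"

definition CCW_transition :: "('s, 'e) triangulation \<Rightarrow> 's list \<Rightarrow> nat \<Rightarrow> bool" where
  "CCW_transition T w j \<longleftrightarrow>
     (let u = curve_orientation T w (Suc j); p = partner T (crossing w j); q = crossing w (Suc j);
          r = third_side T p q
      in lift_cw T (p, u) = (r, u) \<and> lift_cw T (r, u) = (q, u))"

definition glued_above :: "('s, 'e) triangulation \<Rightarrow> 's list \<Rightarrow> nat \<Rightarrow> bool" where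
  "glued_above T w j \<longleftrightarrow>
     (odd j \<and> CCW_transition T w j) \<or> (even j \<and> \<not> CCW_transition T w j)"

fun edge_label :: "('s, 'e) triangulation \<Rightarrow> 's list \<Rightarrow> tile_edge \<Rightarrow> 'e" where
  "edge_label T w (j, South) =
     (if j = 1 then cut_edge T w
      else if glued_above T w (j - 1) then passed_edge T w (j - 1) else crossed_arc T w (j - 1))"
| "edge_label T w (j, West) =
     (if j = 1 then crossed_arc T w (length w)
      else if glued_above T w (j - 1) then crossed_arc T w (j - 1) else passed_edge T w (j - 1))"
| "edge_label T w (j, North) =
     (if j = length w then (if odd j then cut_edge T w else crossed_arc T w 1)
      else if glued_above T w j then passed_edge T w j else crossed_arc T w (Suc j))"
| "edge_label T w (j, East) =
     (if j = length w then (if odd j then crossed_arc T w 1 else cut_edge T w)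
      else if glued_above T w j then crossed_arc T w (Suc j) else passed_edge T w j)"

text \<open>The two edges \<open>a\<close> and \<open>a'\<close> that are identified in the band graph.\<close>

definition first_cut :: tile_edge where
  "first_cut = (1, South)"

definition last_cut :: "'s list \<Rightarrow> tile_edge" where
  "last_cut w = (length w, if odd (length w) then North else East)"

text \<open>
  A good matching of the band graph is represented by the unique perfect matching \<open>P\<close> of the snake graph
  from which it arises by deleting one of \<open>a\<close> and \<open>a'\<close>.
\<close>

definition good_matchings :: "('s, 'e) triangulation \<Rightarrow> 's list \<Rightarrow> tile_edge set set" where
  "good_matchings T w =
     {P. perfect_matching (length w) (glued_above T w) P \<and> (first_cut \<in> P \<or> last_cut w \<in> P)}"

definition remaining_edges :: "'s list \<Rightarrow> tile_edge set \<Rightarrow> tile_edge set" where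
  "remaining_edges w P = P - {if first_cut \<in> P then first_cut else last_cut w}"

definition x_weight :: "('s, 'e) triangulation \<Rightarrow> 's list \<Rightarrow> tile_edge set \<Rightarrow> 'e laurent" where
  "x_weight T w P = (\<Prod>e\<in>remaining_edges w P. xvar (edge_label T w e))"

definition L_oriented ::
    "('s, 'e) triangulation \<Rightarrow> ('e \<Rightarrow> 's lift_side) \<Rightarrow> 's list \<Rightarrow> tile_edge set \<Rightarrow> nat \<Rightarrow> bool" where
  "L_oriented T L w P j \<longleftrightarrow>
     (let up = diagonal_up (length w) (glued_above T w) P j; \<epsilon> = crossing_sign T L w j
      in if odd j then (\<epsilon> = 1 \<and> \<not> up) \<or> (\<epsilon> = -1 \<and> up) else (\<epsilon> = 1 \<and> up) \<or> (\<epsilon> = -1 \<and> \<not> up))"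

definition y_weight ::
    "('s, 'e) triangulation \<Rightarrow> ('e \<Rightarrow> 's lift_side) \<Rightarrow> 's list \<Rightarrow> tile_edge set \<Rightarrow> 'e laurent" where
  "y_weight T L w P = (\<Prod>j\<in>{j\<in>{1..length w}. L_oriented T L w P j}. yvar (crossed_arc T w j))"

definition inverse_cross_monomial :: "('s, 'e) triangulation \<Rightarrow> 's list \<Rightarrow> 'e laurent" where
  "inverse_cross_monomial T w = (\<Prod>j\<in>{1..length w}. xinv (crossed_arc T w j))"

end

theory Submission
  imports Defs
begin

text \<open>
  The trace of every \<open>M\<close>-path and the sum over good matchings are both computed, up to sign, as the trace
  of one product of non-negative \<open>2 \<times> 2\<close> matrices.

  For the matchings, the vertices of the snake graph are sorted by their distance from the initial corner: each
  diagonal joins the two vertices of one level, and every edge joins consecutive levels.  Hence a perfect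
  matching has exactly one edge between any two consecutive levels, so it is determined by the directions of the
  diagonals on its alternating path, and the weighted count is a transfer matrix product.

  For the paths, the elementary steps inside a triangle form a flat connection up to sign, so the trace of a
  closed path only depends on its crossings; a path of the opposite direction has the adjugate matrix.  Turning
  the frame at each crossing according to the orientation transported along the curve transforms the matrix of
  each transition into the transfer matrix of the corresponding gluing of tiles.
\<close>

section \<open>Perfect matchings of snake graphs\<close>

text \<open>Cut open at the base triangle, the curve gives the product of a plain snake graph;
  one-sidedness decides how the two ends are joined. The frames that make all transition matrices
  non-negative depend on the transported orientation, which comes back reversed. So the base change
  does not cancel around the curve: it leaves an antidiagonal factor, which exchanges the columns of
  the closing matrix with rows (x_1, x_a), (0, x_d) and yields the rows (x_a, x_1), (x_d, 0). This
  is the rule for good matchings: 0 excludes matchings with neither a nor a', x_a is what remains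
  when both are present and one is deleted, and x_1, x_d are the labels used at an end where the cut
  edge is absent. Signs are never tracked. Matrices are compared up to one global sign, which
  suffices because the resulting sum has non-negative coefficients and \<open>positive_sign\<close>
  then selects it. Minimality of the crossings enters as the absence of cyclic backtracking: every
  triangle is left through a side other than the one entered, so each transition has one of the two
  shapes of \<open>turn_matrix\<close>.\<close>

fun level :: "tile_edge \<Rightarrow> nat" where
  "level (j, D) = (if D \<in> {North, East} then j else j - 1)"

text \<open>
  The level of a vertex is the sum of its coordinates, and the diagonal of \<open>G\<^sub>i\<close> joins the two vertices
  of level \<open>i\<close>; on level \<open>0\<close> the flag \<open>b\<close> is ignored.
\<close>

definition level_vertex :: "(nat \<Rightarrow> bool) \<Rightarrow> nat \<Rightarrow> bool \<Rightarrow> nat \<times> nat" where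
  "level_vertex A i b = (if i = 0 then (0, 0) else if b then NW_corner A i else SE_corner A i)"

text \<open>The SW corner of a tile is the NW corner of its predecessor exactly when the two are
  glued vertically, whence \<open>A (j - 1)\<close>. The NE corner is the NW corner of the next tile
  when these are glued horizontally, whence \<open>\<not> A j\<close> in \<open>upper_NW\<close>;
  for the last tile this refers to a fictitious successor.\<close>

fun lower_NW :: "(nat \<Rightarrow> bool) \<Rightarrow> tile_edge \<Rightarrow> bool" where
  "lower_NW A (j, D) = (if D \<in> {North, East} then D = North else A (j - 1))"

fun upper_NW :: "(nat \<Rightarrow> bool) \<Rightarrow> tile_edge \<Rightarrow> bool" where
  "upper_NW A (j, D) = (if D \<in> {North, East} then \<not> A j else D = West)"

lemma tile_pos_level: "0 < j \<Longrightarrow> fst (tile_pos A j) + snd (tile_pos A j) = j - 1"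
  by (induction A j rule: tile_pos.induct) (auto simp: Let_def split: prod.splits)

lemma level_vertex_sum: "fst (level_vertex A i b) + snd (level_vertex A i b) = i"
  using tile_pos_level[of i A] by (auto simp: level_vertex_def NW_corner_def SE_corner_def)

lemma level_vertex_eq_iff:
  "level_vertex A i b = level_vertex A i' b' \<longleftrightarrow> i = i' \<and> (i = 0 \<or> b = b')"
proof -
  have "i = i'" if "level_vertex A i b = level_vertex A i' b'"
    using that level_vertex_sum by metis
  then show ?thesis
    by (auto simp: level_vertex_def NW_corner_def SE_corner_def)
qed

lemma NW_corner_level: "0 < j \<Longrightarrow> NW_corner A j = level_vertex A j True"
  and SE_corner_level: "0 < j \<Longrightarrow> SE_corner A j = level_vertex A j False"
  by (auto simp: level_vertex_def)

lemma SW_corner_level: "0 < j \<Longrightarrow> SW_corner A j = level_vertex A (j - 1) (A (j - 1))"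
  by (cases "(A, j)" rule: tile_pos.cases)
    (auto simp: level_vertex_def SW_corner_def NW_corner_def SE_corner_def Let_def split: prod.splits)

lemma NE_corner_level: "0 < j \<Longrightarrow> NE_corner A j = level_vertex A (Suc j) (\<not> A j)"
  by (cases j)
    (auto simp: level_vertex_def NE_corner_def NW_corner_def SE_corner_def Let_def split: prod.splits)

lemma edge_ends_level:
  assumes "e \<in> snake_edges d A"
  shows "edge_ends A e =
    {level_vertex A (level e) (lower_NW A e), level_vertex A (Suc (level e)) (upper_NW A e)}"
proof -
  obtain j D where e: "e = (j, D)" by (cases e)
  have j: "0 < j" using assms e by (auto simp: snake_edges_def)
  show ?thesis
    using j e by (cases D) (auto simp: NW_corner_level SE_corner_level SW_corner_level NE_corner_level)
qed

lemma level_le: "\<lbrakk>e \<in> snake_edges d A; 0 < d\<rbrakk> \<Longrightarrow> level e \<le> d"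
  by (auto simp: snake_edges_def split: if_splits)

lemma mem_edge_ends_iff:
  assumes "e \<in> snake_edges d A"
  shows "level_vertex A i b \<in> edge_ends A e \<longleftrightarrow>
    i = level e \<and> (i = 0 \<or> b = lower_NW A e) \<or> i = Suc (level e) \<and> b = upper_NW A e"
  unfolding edge_ends_level[OF assms] by (auto simp: level_vertex_eq_iff)

text \<open>
  Here \<open>c i\<close> says that the diagonal of \<open>G\<^sub>i\<close> is directed up, so that the alternating path enters level \<open>i\<close>
  in the SE corner and leaves it in the NW corner.  Of the four conceivable edges between the levels \<open>i\<close>
  and \<open>i + 1\<close> exactly one is missing in the snake graph; for the corresponding \<open>c\<close> the value of
  \<open>level_edge\<close> is meaningless.
\<close>

definition admissible :: "nat \<Rightarrow> (nat \<Rightarrow> bool) \<Rightarrow> (nat \<Rightarrow> bool) \<Rightarrow> bool" where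
  "admissible d A c \<longleftrightarrow> (\<forall>i\<in>{1..<d}. c i = A i \<or> c (Suc i) = A i)"

definition level_edge :: "nat \<Rightarrow> (nat \<Rightarrow> bool) \<Rightarrow> (nat \<Rightarrow> bool) \<Rightarrow> nat \<Rightarrow> tile_edge" where
  "level_edge d A c i =
     (if i = 0 then (1, if c 1 then South else West)
      else if i = d \<or> c (Suc i) = A i then (i, if c i then North else East)
      else (Suc i, if A i then West else South))"

definition matching_of :: "nat \<Rightarrow> (nat \<Rightarrow> bool) \<Rightarrow> (nat \<Rightarrow> bool) \<Rightarrow> tile_edge set" where
  "matching_of d A c = level_edge d A c ` {0..d}"

lemma level_edge_props:
  assumes "0 < d" "i \<le> d" "admissible d A c"
  shows level_edge_in: "level_edge d A c i \<in> snake_edges d A"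
    and level_level_edge: "level (level_edge d A c i) = i"
    and lower_level_edge: "0 < i \<Longrightarrow> lower_NW A (level_edge d A c i) = c i"
    and upper_level_edge: "upper_NW A (level_edge d A c i) = (if i = d then \<not> A d else \<not> c (Suc i))"
  using assms by (force simp: level_edge_def snake_edges_def admissible_def)+

lemma snake_edges_cases:
  assumes "e \<in> snake_edges d A"
  obtains "e = (1, South)" | "e = (1, West)" | j where "e = (j, North)" "0 < j" "j \<le> d"
    | j where "e = (j, East)" "0 < j" "j \<le> d"
    | j where "e = (Suc j, West)" "0 < j" "j < d" "A j"
    | j where "e = (Suc j, South)" "0 < j" "j < d" "\<not> A j"
  using assms by (auto simp: snake_edges_def split: if_splits)

text \<open>Two vertices of neighbouring levels are joined by at most one edge, so the ends
  determine the edge. The second conclusion, that the pair of vertices without an edge is avoided,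
  later yields admissibility.\<close>

lemma level_edge_unique:
  assumes e: "e \<in> snake_edges d A" and i: "i = level e" and d: "0 < d"
    and lower: "0 < i \<longrightarrow> lower_NW A e = c i" and upper: "i < d \<longrightarrow> upper_NW A e = (\<not> c (Suc i))"
  shows "e = level_edge d A c i \<and> (0 < i \<longrightarrow> i < d \<longrightarrow> c i = A i \<or> c (Suc i) = A i)"
  using e
proof (cases rule: snake_edges_cases)
  case 1
  then show ?thesis using i upper d by (simp add: level_edge_def)
next
  case 2
  then show ?thesis using i upper d by (simp add: level_edge_def)
next
  case (3 j)
  then show ?thesis using i upper lower d by (cases "j = d") (simp_all add: level_edge_def)
next
  case (4 j)
  then show ?thesis using i upper lower d by (cases "j = d") (simp_all add: level_edge_def)
next
  case (5 j)
  then show ?thesis using i upper lower d by (cases "c (Suc j)") (simp_all add: level_edge_def)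
next
  case (6 j)
  then show ?thesis using i upper lower d by (cases "c (Suc j)") (simp_all add: level_edge_def)
qed

lemma snake_vertices_level:
  assumes "0 < d" "v \<in> snake_vertices d A"
  obtains i b where "v = level_vertex A i b" "i \<le> d \<or> (i = Suc d \<and> b = (\<not> A d))"
proof -
  obtain e where e: "e \<in> snake_edges d A" "v \<in> edge_ends A e"
    using assms by (auto simp: snake_vertices_def)
  have "level e = d \<Longrightarrow> upper_NW A e = (\<not> A d)"
    using e assms(1) by (auto simp: snake_edges_def split: if_splits)
  then show ?thesis
    using e(2) level_le[OF e(1) assms(1)] that[of "level e" "lower_NW A e"]
      that[of "Suc (level e)" "upper_NW A e"]
    unfolding edge_ends_level[OF e(1)] by (cases "level e = d") auto
qed

lemma level_vertex_in:
  assumes "0 < d" "i \<le> d"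
  shows "level_vertex A i b \<in> snake_vertices d A"
proof (cases "i = 0")
  case True
  have "(1, South) \<in> snake_edges d A" by (simp add: snake_edges_def)
  moreover have "level_vertex A i b \<in> edge_ends A (1, South)"
    using mem_edge_ends_iff[OF calculation, of i b] True by simp
  ultimately show ?thesis unfolding snake_vertices_def by blast
next
  case False
  have "(i, if b then North else East) \<in> snake_edges d A" (is "?e \<in> _")
    using False assms by (auto simp: snake_edges_def)
  moreover have "level_vertex A i b \<in> edge_ends A ?e"
    unfolding mem_edge_ends_iff[OF calculation] by simp
  ultimately show ?thesis unfolding snake_vertices_def by blast
qed

lemma matching_of_perfect:
  assumes "0 < d" "admissible d A c"
  shows "perfect_matching d A (matching_of d A c)"
  unfolding perfect_matching_def
proof (intro conjI ballI)
  show "matching_of d A c \<subseteq> snake_edges d A"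
    using level_edge_in[OF assms(1) _ assms(2)] by (auto simp: matching_of_def)
next
  fix v assume "v \<in> snake_vertices d A"
  then obtain i b where v: "v = level_vertex A i b" and ib: "i \<le> d \<or> (i = Suc d \<and> b = (\<not> A d))"
    using snake_vertices_level[OF assms(1)] by metis
  have *: "v \<in> edge_ends A (level_edge d A c k) \<longleftrightarrow>
    i = k \<and> (i = 0 \<or> b = c i) \<or> i = Suc k \<and> b = (if k = d then \<not> A d else \<not> c (Suc k))"
    if "k \<le> d" for k
    unfolding v mem_edge_ends_iff[OF level_edge_in[OF assms(1) that assms(2)]]
    using level_edge_props[OF assms(1) that assms(2)] by auto
  \<comment> \<open>A vertex of level \<open>i\<close> is matched upwards if the alternating path
    leaves the level there, and downwards otherwise; the corner of level 0 can only be matched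
    upwards.\<close>
  define k where "k = (if i = 0 \<or> i \<le> d \<and> b = c i then i else i - 1)"
  have "k \<le> d" using ib by (auto simp: k_def)
  moreover have "v \<in> edge_ends A (level_edge d A c k)"
    using ib unfolding *[OF \<open>k \<le> d\<close>] by (auto simp: k_def)
  moreover have "k' = k" if "k' \<le> d" "v \<in> edge_ends A (level_edge d A c k')" for k'
    using that ib unfolding *[OF \<open>k' \<le> d\<close>] by (auto simp: k_def split: if_splits)
  ultimately have "\<exists>!k. k \<in> {0..d} \<and> v \<in> edge_ends A (level_edge d A c k)"
    by (metis atLeastAtMost_iff zero_le)
  then show "\<exists>!e. e \<in> matching_of d A c \<and> v \<in> edge_ends A e"
    unfolding matching_of_def by (elim ex1E, intro ex1I) blast+
qed

text \<open>Induction over the levels: of the two vertices of a level, one is the upper end of the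
  only edge below. The other one must be covered from above, and a further edge above would cover
  one of the two vertices twice.\<close>

lemma perfect_matching_is_matching_of:
  assumes "0 < d" "perfect_matching d A P"
  obtains c where "admissible d A c" "P = matching_of d A c"
proof -
  have sub: "e \<in> snake_edges d A" if "e \<in> P" for e
    using assms(2) that by (auto simp: perfect_matching_def)
  have cover: "\<exists>e. e \<in> P \<and> level_vertex A i b \<in> edge_ends A e" if "i \<le> d" for i b
    using assms(2) level_vertex_in[OF assms(1) that] unfolding perfect_matching_def by blast
  have once: "e = e'" if "i \<le> d" "e \<in> P" "e' \<in> P" "level_vertex A i b \<in> edge_ends A e"
    "level_vertex A i b \<in> edge_ends A e'" for i b e e'
    using assms(2) level_vertex_in[OF assms(1) that(1)] that(2-) unfolding perfect_matching_def by blast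
  have next_level: "\<exists>e'. e' \<in> P \<and> level e' = Suc i \<and> lower_NW A e' = (\<not> upper_NW A e) \<and>
      (\<forall>e''\<in>P. level e'' = Suc i \<longrightarrow> e'' = e')"
    if i: "i < d" and e: "e \<in> P" "level e = i" and uniq: "\<forall>e'\<in>P. level e' = i \<longrightarrow> e' = e" for i e
  proof -
    let ?h = "upper_NW A e"
    obtain e' where e': "e' \<in> P" "level_vertex A (Suc i) (\<not> ?h) \<in> edge_ends A e'"
      using cover[of "Suc i" "\<not> ?h"] i by auto
    have "level e' \<noteq> i" using uniq e' mem_edge_ends_iff[OF sub[OF e'(1)]] by auto
    then have lev: "level e' = Suc i" "lower_NW A e' = (\<not> ?h)"
      using e'(2) unfolding mem_edge_ends_iff[OF sub[OF e'(1)]] by auto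
    have "e'' = e'" if e'': "e'' \<in> P" "level e'' = Suc i" for e''
    proof (cases "lower_NW A e'' = ?h")
      case True
      then have "e'' = e"
        using once[of "Suc i" e'' e ?h] i e e'' mem_edge_ends_iff[OF sub[OF e(1)]]
          mem_edge_ends_iff[OF sub[OF e''(1)]] by auto
      then show ?thesis using e e'' by auto
    next
      case False
      then show ?thesis
        using once[of "Suc i" e'' e' "\<not> ?h"] i e' e'' mem_edge_ends_iff[OF sub[OF e''(1)]] by auto
    qed
    then show ?thesis using e' lev by blast
  qed
  have unique_level: "\<exists>!e. e \<in> P \<and> level e = i" if "i \<le> d" for i
    using that
  proof (induction i)
    case 0
    obtain e where e: "e \<in> P" "level_vertex A 0 True \<in> edge_ends A e" using cover by blast
    then have "level e = 0" using mem_edge_ends_iff[OF sub[OF e(1)]] by auto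
    moreover have "e' = e" if "e' \<in> P" "level e' = 0" for e'
      using once[of 0 e' e True] e that mem_edge_ends_iff[OF sub[OF that(1)]] by auto
    ultimately show ?case using e by blast
  next
    case (Suc i)
    then have "\<exists>!e. e \<in> P \<and> level e = i" by simp
    then obtain e where e: "e \<in> P" "level e = i" "\<forall>e'\<in>P. level e' = i \<longrightarrow> e' = e"
      by (elim ex1E) blast
    obtain e' where "e' \<in> P \<and> level e' = Suc i" "\<forall>e''\<in>P. level e'' = Suc i \<longrightarrow> e'' = e'"
      using next_level[OF Suc_le_lessD[OF Suc.prems] e] by blast
    then show ?case by (intro ex1I[of _ e']) blast+
  qed
  define E where "E i = (THE e. e \<in> P \<and> level e = i)" for i
  have E: "E i \<in> P" "level (E i) = i" if "i \<le> d" for i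
    using theI'[OF unique_level[OF that]] by (auto simp: E_def)
  have E_unique: "e = E (level e)" if "e \<in> P" for e
    using unique_level[OF level_le[OF sub[OF that] assms(1)]] that
    by (simp add: E_def the1_equality)
  have lower_E: "lower_NW A (E (Suc i)) = (\<not> upper_NW A (E i))" if "i < d" for i
  proof -
    have i: "i \<le> d" "Suc i \<le> d" using that by auto
    have "\<forall>e\<in>P. level e = i \<longrightarrow> e = E i" using E_unique by auto
    from next_level[OF that E[OF i(1)] this] obtain e'
      where "lower_NW A e' = (\<not> upper_NW A (E i))" "\<forall>e\<in>P. level e = Suc i \<longrightarrow> e = e'"
      by blast
    then show ?thesis using E[OF i(2)] by simp
  qed
  \<comment> \<open>The path enters level \<open>i\<close> at the upper end of the edge below; the
    diagonal is directed up when this is the SE corner.\<close>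
  define c where "c i = (\<not> upper_NW A (E (i - 1)))" for i
  have *: "E i = level_edge d A c i \<and> (0 < i \<longrightarrow> i < d \<longrightarrow> c i = A i \<or> c (Suc i) = A i)"
    if i: "i \<le> d" for i
  proof (rule level_edge_unique[OF sub[OF E(1)[OF i]] E(2)[OF i, symmetric] assms(1)])
    show "0 < i \<longrightarrow> lower_NW A (E i) = c i" using lower_E[of "i - 1"] i by (cases i) (simp_all add: c_def)
    show "i < d \<longrightarrow> upper_NW A (E i) = (\<not> c (Suc i))" by (simp add: c_def)
  qed
  have "P = matching_of d A c"
  proof
    show "P \<subseteq> matching_of d A c"
    proof
      fix e assume "e \<in> P"
      then have "e = level_edge d A c (level e)" "level e \<in> {0..d}"
        using E_unique[of e] level_le[OF sub assms(1), of e] *[of "level e"] by simp_all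
      then show "e \<in> matching_of d A c" unfolding matching_of_def by (rule image_eqI)
    qed
    have "level_edge d A c i \<in> P" if "i \<le> d" for i using E(1)[OF that] *[OF that] by simp
    then show "matching_of d A c \<subseteq> P" unfolding matching_of_def by auto
  qed
  moreover have "admissible d A c" unfolding admissible_def using * by simp
  ultimately show thesis using that by simp
qed

lemma matching_of_inj:
  assumes "0 < d" "admissible d A c" "admissible d A c'" "matching_of d A c = matching_of d A c'"
    and "i \<in> {1..d}"
  shows "c i = c' i"
proof -
  have "level_edge d A c i \<in> level_edge d A c' ` {0..d}"
    using assms(5) unfolding assms(4)[unfolded matching_of_def, symmetric] by auto
  then obtain k where k: "k \<le> d" "level_edge d A c i = level_edge d A c' k" by auto
  then have "k = i"
    using level_level_edge[OF assms(1) _ assms(2), of i] level_level_edge[OF assms(1) k(1) assms(3)] assms(5)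
    by auto
  then show ?thesis
    using k lower_level_edge[OF assms(1) _ assms(2), of i] lower_level_edge[OF assms(1) _ assms(3), of i] assms(5)
    by auto
qed

section \<open>The alternating path of a matching and the directions of the diagonals\<close>

definition path_vertex :: "nat \<Rightarrow> (nat \<Rightarrow> bool) \<Rightarrow> (nat \<Rightarrow> bool) \<Rightarrow> nat \<Rightarrow> nat \<times> nat" where
  "path_vertex d A c k =
     (if even k then level_vertex A (k div 2) (c (k div 2))
      else level_vertex A (Suc (k div 2)) (if k div 2 = d then \<not> A d else \<not> c (Suc (k div 2))))"

lemma path_vertex_even: "path_vertex d A c (2 * i) = level_vertex A i (c i)"
  and path_vertex_odd: "path_vertex d A c (Suc (2 * i)) =
    level_vertex A (Suc i) (if i = d then \<not> A d else \<not> c (Suc i))"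
  by (simp_all add: path_vertex_def)

lemma edge_ends_level_edge:
  assumes "0 < d" "i \<le> d" "admissible d A c"
  shows "edge_ends A (level_edge d A c i) = {path_vertex d A c (2 * i), path_vertex d A c (Suc (2 * i))}"
  unfolding edge_ends_level[OF level_edge_in[OF assms]]
  using level_edge_props[OF assms] by (auto simp: path_vertex_def level_vertex_def)

lemma diagonal_ends: "0 < j \<Longrightarrow> {NW_corner A j, SE_corner A j} = {level_vertex A j b, level_vertex A j (\<not> b)}"
  by (cases b) (auto simp: level_vertex_def)

lemma alternating_path_exists:
  assumes "0 < d" "admissible d A c"
  shows "alternating_path d A (matching_of d A c) (map (path_vertex d A c) [0..<2 * d + 2])"
  unfolding alternating_path_def
proof (intro conjI allI impI)
  let ?vs = "map (path_vertex d A c) [0..<2 * d + 2]"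
  show "hd ?vs = SW_corner A 1"
    by (simp add: hd_map path_vertex_def level_vertex_def SW_corner_def del: upt_Suc)
  show "last ?vs = NE_corner A d"
    using assms(1) by (simp add: last_map path_vertex_def NE_corner_level)
  fix k assume k: "Suc k < length ?vs"
  then have vs: "?vs ! k = path_vertex d A c k" "?vs ! Suc k = path_vertex d A c (Suc k)"
    by (simp_all del: upt_Suc)
  show "if even k then \<exists>e\<in>matching_of d A c. {?vs ! k, ?vs ! Suc k} = edge_ends A e
      else \<exists>j\<in>{1..d}. {?vs ! k, ?vs ! Suc k} = {NW_corner A j, SE_corner A j}"
  proof (cases "even k")
    case True
    then obtain i where i: "k = 2 * i" by blast
    then have "i \<le> d" using k by simp
    then have "level_edge d A c i \<in> matching_of d A c" by (simp add: matching_of_def)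
    moreover have "{?vs ! k, ?vs ! Suc k} = edge_ends A (level_edge d A c i)"
      unfolding vs unfolding i edge_ends_level_edge[OF assms(1) \<open>i \<le> d\<close> assms(2)] ..
    ultimately show ?thesis using True by auto
  next
    case False
    then obtain i where i: "k = 2 * i + 1" by (elim oddE)
    have "i < d" using k i by simp
    then have "{?vs ! k, ?vs ! Suc k} = {NW_corner A (Suc i), SE_corner A (Suc i)}"
      unfolding vs unfolding i diagonal_ends[of "Suc i" A "\<not> c (Suc i)", simplified]
      by (simp add: path_vertex_def)
    then show ?thesis using False \<open>i < d\<close> by (auto intro!: bexI[of _ "Suc i"])
  qed
qed simp_all

text \<open>Every step is forced, since a vertex lies on one edge of the matching and on at most one
  diagonal. The bound on \<open>k\<close> is carried along because the final corner lies on no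
  diagonal, so the path stops there. Uniqueness matters since \<open>diagonal_up\<close> quantifies
  over all alternating paths.\<close>

lemma alternating_path_unique:
  assumes "0 < d" "admissible d A c" "alternating_path d A (matching_of d A c) vs" "k < length vs"
  shows "vs ! k = path_vertex d A c k \<and> k div 2 \<le> d"
  using assms(4)
proof (induction k)
  case 0
  then show ?case
    using assms(3)
    by (auto simp: alternating_path_def path_vertex_def level_vertex_def SW_corner_def hd_conv_nth)
next
  case (Suc k)
  have IH: "vs ! k = path_vertex d A c k" "k div 2 \<le> d" using Suc by auto
  have step: "if even k then \<exists>e\<in>matching_of d A c. {vs ! k, vs ! Suc k} = edge_ends A e
      else \<exists>j\<in>{1..d}. {vs ! k, vs ! Suc k} = {NW_corner A j, SE_corner A j}"
    using assms(3) Suc.prems unfolding alternating_path_def by blast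
  show ?case
  proof (cases "even k")
    case True
    then obtain i where i: "k = 2 * i" by blast
    then have "i \<le> d" using IH by simp
    obtain k' where k': "k' \<le> d" and e: "{vs ! k, vs ! Suc k} = edge_ends A (level_edge d A c k')"
      using step True by (auto simp: matching_of_def)
    have "path_vertex d A c (2 * i) \<in> edge_ends A (level_edge d A c k')"
      unfolding e[symmetric] using IH i by simp
    then have "path_vertex d A c (2 * i) = path_vertex d A c (2 * k') \<or>
        path_vertex d A c (2 * i) = path_vertex d A c (Suc (2 * k'))"
      unfolding edge_ends_level_edge[OF assms(1) k' assms(2)] by simp
    \<comment> \<open>The edge one level lower is excluded: it ends where the path enters level
      \<open>i\<close>, not where it leaves.\<close>
    then have "k' = i"
      using \<open>i \<le> d\<close> by (auto simp: path_vertex_def level_vertex_eq_iff split: if_splits)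
    then have "{vs ! k, vs ! Suc k} = {path_vertex d A c k, path_vertex d A c (Suc k)}"
      using e edge_ends_level_edge[OF assms(1) k' assms(2)] i by simp
    then show ?thesis using IH i \<open>i \<le> d\<close> by (auto simp: doubleton_eq_iff)
  next
    case False
    then obtain i where i: "k = 2 * i + 1" by (elim oddE)
    obtain j where j: "j \<in> {1..d}" and e: "{vs ! k, vs ! Suc k} = {NW_corner A j, SE_corner A j}"
      using step False by auto
    let ?b = "if i = d then \<not> A d else \<not> c (Suc i)"
    have eq: "{level_vertex A (Suc i) ?b, vs ! Suc k} = {level_vertex A j ?b, level_vertex A j (\<not> ?b)}"
      using e IH i diagonal_ends[of j A ?b] j by (simp add: path_vertex_odd)
    then have "level_vertex A (Suc i) ?b \<in> {level_vertex A j ?b, level_vertex A j (\<not> ?b)}" by blast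
    then have "j = Suc i" by (auto simp: level_vertex_eq_iff)
    then have "vs ! Suc k = level_vertex A j (\<not> ?b)"
      using eq by (auto simp: doubleton_eq_iff)
    then show ?thesis using \<open>j = Suc i\<close> j i by (simp add: path_vertex_def)
  qed
qed

lemma diagonal_up_matching_of:
  assumes "0 < d" "admissible d A c" "j \<in> {1..d}"
  shows "diagonal_up d A (matching_of d A c) j \<longleftrightarrow> c j"
proof
  assume "diagonal_up d A (matching_of d A c) j"
  then obtain vs k where vs: "alternating_path d A (matching_of d A c) vs" "odd k" "Suc k < length vs"
    "vs ! k = SE_corner A j"
    unfolding diagonal_up_def by blast
  then obtain i where i: "k = 2 * i + 1" by (elim oddE)
  have "i < d"
    using alternating_path_unique[OF assms(1,2) vs(1,3)] i by simp
  moreover have "path_vertex d A c k = level_vertex A j False"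
    using alternating_path_unique[OF assms(1,2) vs(1), of k] vs assms(3) by (simp add: SE_corner_level)
  ultimately show "c j" using i by (auto simp: path_vertex_def level_vertex_eq_iff)
next
  assume "c j"
  define i where "i = j - 1"
  let ?vs = "map (path_vertex d A c) [0..<2 * d + 2]" and ?k = "2 * i + 1"
  have k: "Suc ?k < length ?vs" and j: "j = Suc i" "i < d" using assms(3) by (auto simp: i_def)
  then have "?vs ! ?k = path_vertex d A c ?k" "?vs ! Suc ?k = path_vertex d A c (Suc ?k)"
    by (simp_all del: upt_Suc)
  then have "?vs ! ?k = SE_corner A j" "?vs ! Suc ?k = NW_corner A j"
    using \<open>c j\<close> j by (simp_all add: path_vertex_def level_vertex_def)
  then show "diagonal_up d A (matching_of d A c) j"
    unfolding diagonal_up_def using alternating_path_exists[OF assms(1,2)] k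
    by (intro exI[of _ ?vs] exI[of _ ?k]) simp
qed

lemma level_edge_cong:
  assumes "\<And>i. i \<in> {1..d} \<Longrightarrow> c i = c' i" "i \<le> d" "0 < d"
  shows "level_edge d A c i = level_edge d A c' i"
proof -
  have "0 < i \<Longrightarrow> c i = c' i" "i < d \<Longrightarrow> c (Suc i) = c' (Suc i)" "c (Suc 0) = c' (Suc 0)"
    using assms by auto
  then show ?thesis using assms(2) by (cases "i = d") (auto simp: level_edge_def)
qed

lemma mem_matching_of_iff:
  assumes "0 < d" "admissible d A c" "level e \<le> d"
  shows "e \<in> matching_of d A c \<longleftrightarrow> e = level_edge d A c (level e)"
  using assms level_level_edge[OF assms(1) _ assms(2)] by (force simp: matching_of_def)

section \<open>Two by two matrices up to sign\<close>

lemma mat2_mult [simp]: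
  fixes a b c d :: "'a::comm_ring_1"
  shows "mat2 a b c d ** mat2 a' b' c' d' =
    mat2 (a * a' + b * c') (a * b' + b * d') (c * a' + d * c') (c * b' + d * d')"
  by (simp add: mat2_def matrix_matrix_mult_def vec_eq_iff forall_2 sum_2)

lemma mat2_uminus [simp]: "- mat2 a b c d = mat2 (- a) (- b) (- c) (- d :: 'a::comm_ring_1)"
  by (simp add: mat2_def vec_eq_iff forall_2)

lemma mat2_eq_iff: "mat2 a b c d = mat2 a' b' c' d' \<longleftrightarrow> a = a' \<and> b = b' \<and> c = c' \<and> d = (d' :: 'a::comm_ring_1)"
  by (auto simp: mat2_def vec_eq_iff forall_2)

lemma mat_1_mat2: "mat 1 = mat2 1 0 0 (1 :: 'a::comm_ring_1)"
  by (simp add: mat2_def mat_def vec_eq_iff forall_2)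

lemma trace_mat2: "trace (mat2 a b c d) = a + (d :: 'a::comm_ring_1)"
  by (simp add: trace_def mat2_def sum_2)

lemma mat2_cases: obtains a b c d where "M = mat2 a b c (d :: 'a::comm_ring_1)"
proof
  show "M = mat2 (M $ 1 $ 1) (M $ 1 $ 2) (M $ 2 $ 1) (M $ 2 $ 2)"
    by (simp add: mat2_def vec_eq_iff forall_2)
qed

text \<open>One sign for the whole matrix rather than one for each entry; only so does the relation
  pass to products and traces.\<close>

definition eq_sign :: "'a::uminus \<Rightarrow> 'a \<Rightarrow> bool" (infix "=\<^sub>\<plusminus>" 50) where
  "f =\<^sub>\<plusminus> g \<longleftrightarrow> f = g \<or> f = - g"

lemma eq_sign_refl [simp]: "f =\<^sub>\<plusminus> f"
  by (simp add: eq_sign_def)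

lemma eq_sign_sym: "f =\<^sub>\<plusminus> g \<Longrightarrow> g =\<^sub>\<plusminus> (f :: 'a::group_add)"
  by (auto simp: eq_sign_def)

lemma eq_sign_trans [trans]: "f =\<^sub>\<plusminus> g \<Longrightarrow> g =\<^sub>\<plusminus> h \<Longrightarrow> f =\<^sub>\<plusminus> (h :: 'a::group_add)"
  by (auto simp: eq_sign_def)

lemma eq_eq_sign_trans [trans]: "f = g \<Longrightarrow> g =\<^sub>\<plusminus> h \<Longrightarrow> f =\<^sub>\<plusminus> h"
  and eq_sign_eq_trans [trans]: "f =\<^sub>\<plusminus> g \<Longrightarrow> g = h \<Longrightarrow> f =\<^sub>\<plusminus> h"
  by simp_all

lemma uminus_matrix_mult: "(- A) ** B = - (A ** (B :: 'a::comm_ring_1^2^2))"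
  and matrix_mult_uminus: "A ** (- B) = - (A ** (B :: 'a::comm_ring_1^2^2))"
  by (simp_all add: matrix_matrix_mult_def vec_eq_iff sum_negf)

lemma eq_sign_matrix_mult:
  fixes A B C D :: "'a::comm_ring_1^2^2"
  shows "A =\<^sub>\<plusminus> B \<Longrightarrow> C =\<^sub>\<plusminus> D \<Longrightarrow> A ** C =\<^sub>\<plusminus> B ** D"
  by (auto simp: eq_sign_def uminus_matrix_mult matrix_mult_uminus)

lemma eq_sign_trace:
  fixes A B :: "'a::comm_ring_1^2^2"
  shows "A =\<^sub>\<plusminus> B \<Longrightarrow> trace A =\<^sub>\<plusminus> trace B"
  by (auto simp: eq_sign_def trace_def sum_negf)

lemma xvar_xinv: "xvar e * xinv e = 1" "xinv e * xvar e = 1"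
  by (simp_all add: xvar_def xinv_def mult_single single_add[symmetric] one_poly_mapping_def)

definition adj2 :: "'a::comm_ring_1^2^2 \<Rightarrow> 'a^2^2" where
  "adj2 M = mat2 (M $ 2 $ 2) (- M $ 1 $ 2) (- M $ 2 $ 1) (M $ 1 $ 1)"

lemma adj2_mat2 [simp]: "adj2 (mat2 a b c d) = mat2 d (- b) (- c) (a :: 'a::comm_ring_1)"
  by (simp add: adj2_def mat2_def)

lemma adj2_mult: "adj2 (A ** B) = adj2 B ** adj2 (A :: 'a::comm_ring_1^2^2)"
  by (cases A rule: mat2_cases, cases B rule: mat2_cases) (simp add: mat2_eq_iff algebra_simps)

lemma trace_adj2: "trace (adj2 A) = trace (A :: 'a::comm_ring_1^2^2)"
  by (cases A rule: mat2_cases) (simp add: trace_mat2 add.commute)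

lemma adj2_mat_1: "adj2 (mat 1) = (mat 1 :: 'a::comm_ring_1^2^2)"
  by (simp add: mat_1_mat2)

section \<open>Transfer matrix products as sums over subsets\<close>

primrec walk_matrix :: "(nat \<Rightarrow> 'a::comm_ring_1^2^2) \<Rightarrow> (nat \<Rightarrow> 'a^2^2) \<Rightarrow> nat \<Rightarrow> 'a^2^2" where
  "walk_matrix K Q 0 = K 1"
| "walk_matrix K Q (Suc n) = K (Suc (Suc n)) ** Q (Suc n) ** walk_matrix K Q n"

definition mat2_index :: "bool \<Rightarrow> 2" where
  "mat2_index b = (if b then 1 else 2)"

lemma mat2_entries [simp]:
  "mat2 a b c d $ mat2_index True $ mat2_index True = a"
  "mat2 a b c d $ mat2_index True $ mat2_index False = b"
  "mat2 a b c d $ mat2_index False $ mat2_index True = c"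
  "mat2 a b c d $ mat2_index False $ mat2_index False = d"
  by (simp_all add: mat2_index_def mat2_def)

lemma matrix_mult_entry:
  fixes M N :: "'a::comm_ring_1^2^2"
  shows "(M ** N) $ i $ j = M $ i $ mat2_index True * N $ mat2_index True $ j +
    M $ i $ mat2_index False * N $ mat2_index False $ j"
  by (simp add: matrix_matrix_mult_def sum_2 mat2_index_def)

lemma trace_entries: "trace M = M $ mat2_index True $ mat2_index True + M $ mat2_index False $ mat2_index False"
  by (simp add: trace_def sum_2 mat2_index_def)

lemma sum_Pow_Suc:
  fixes f :: "nat set \<Rightarrow> 'a::comm_monoid_add"
  shows "(\<Sum>C\<in>Pow {1..Suc n}. f C) = (\<Sum>C\<in>Pow {1..n}. f (insert (Suc n) C) + f C)"
proof -
  have "{1..Suc n} = insert (Suc n) {1..n}" by auto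
  then have "(\<Sum>C\<in>Pow {1..Suc n}. f C) = (\<Sum>C\<in>Pow {1..n} \<union> insert (Suc n) ` Pow {1..n}. f C)"
    by (simp only: Pow_insert)
  also have "\<dots> = (\<Sum>C\<in>Pow {1..n}. f C) + (\<Sum>C\<in>insert (Suc n) ` Pow {1..n}. f C)"
    by (intro sum.union_disjoint) auto
  also have "(\<Sum>C\<in>insert (Suc n) ` Pow {1..n}. f C) = (\<Sum>C\<in>Pow {1..n}. f (insert (Suc n) C))"
  proof (rule sum.reindex_cong[OF _ HOL.refl HOL.refl])
    have "C = insert (Suc n) C - {Suc n}" if "C \<in> Pow {1..n}" for C using that by auto
    then show "inj_on (insert (Suc n)) (Pow {1..n})" by (metis inj_onI)
  qed
  finally show ?thesis by (simp add: sum.distrib add.commute)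
qed

text \<open>Expanding the product gives one term for each sequence of coordinates, encoded by the
  set \<open>C\<close> of positions where the first coordinate is taken. The boundary factor
  \<open>h\<close> is arbitrary so that the induction can absorb the last step into it.\<close>

lemma walk_matrix_sum:
  fixes h :: "bool \<Rightarrow> bool \<Rightarrow> 'a::comm_ring_1" and Q :: "nat \<Rightarrow> 'a^2^2"
  assumes K: "\<And>j. K j = mat2 (\<kappa> j True) 0 0 (\<kappa> j False)"
  defines "weight n C \<equiv> (\<Prod>i\<in>{1..n}. Q i $ mat2_index (Suc i \<in> C) $ mat2_index (i \<in> C)) *
    (\<Prod>i\<in>{1..Suc n}. \<kappa> i (i \<in> C))"
  shows "(\<Sum>C\<in>Pow {1..Suc n}. h (1 \<in> C) (Suc n \<in> C) * weight n C) =
    (\<Sum>s\<in>UNIV. \<Sum>e\<in>UNIV. h s e * walk_matrix K Q n $ mat2_index e $ mat2_index s)"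
proof (induction n arbitrary: h)
  case 0
  show ?case unfolding sum_Pow_Suc by (simp add: weight_def UNIV_bool K)
next
  case (Suc n)
  let ?m = "Suc (Suc n)"
  let ?q = "\<lambda>e e'. Q (Suc n) $ mat2_index e $ mat2_index e' * \<kappa> ?m e"
  let ?h = "\<lambda>s e'. h s True * ?q True e' + h s False * ?q False e'"
  have weight: "weight (Suc n) C = ?q (?m \<in> C) (Suc n \<in> C) * weight n C" for C
    by (simp add: weight_def mult_ac)
  have weight_insert: "weight n (insert ?m C) = weight n C" for C
    by (auto simp: weight_def intro!: arg_cong2[of _ _ _ _ "(*)"] prod.cong)
  have "h (1 \<in> insert ?m C) (?m \<in> insert ?m C) * weight (Suc n) (insert ?m C) +
      h (1 \<in> C) (?m \<in> C) * weight (Suc n) C = ?h (1 \<in> C) (Suc n \<in> C) * weight n C"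
    if "C \<in> Pow {1..Suc n}" for C
  proof -
    have "?m \<notin> C" using that by auto
    then show ?thesis unfolding weight weight_insert by (simp add: algebra_simps)
  qed
  then have "(\<Sum>C\<in>Pow {1..?m}. h (1 \<in> C) (?m \<in> C) * weight (Suc n) C) =
      (\<Sum>C\<in>Pow {1..Suc n}. ?h (1 \<in> C) (Suc n \<in> C) * weight n C)"
    unfolding sum_Pow_Suc[of _ "Suc n"] by (rule sum.cong[OF HOL.refl])
  also have "\<dots> = (\<Sum>s\<in>UNIV. \<Sum>e\<in>UNIV. ?h s e * walk_matrix K Q n $ mat2_index e $ mat2_index s)"
    by (rule Suc.IH)
  also have "\<dots> = (\<Sum>s\<in>UNIV. \<Sum>e\<in>UNIV. h s e * walk_matrix K Q (Suc n) $ mat2_index e $ mat2_index s)"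
    by (simp add: UNIV_bool matrix_mult_entry K algebra_simps)
  finally show ?case .
qed

section \<open>Positive Laurent polynomials\<close>

definition nonneg_laurent :: "'e laurent \<Rightarrow> bool" where
  "nonneg_laurent f \<longleftrightarrow> (\<forall>m. 0 \<le> Poly_Mapping.lookup f m)"

definition laurent_monomial :: "'e laurent \<Rightarrow> bool" where
  "laurent_monomial f \<longleftrightarrow> (\<exists>m. f = Poly_Mapping.single m 1)"

lemma laurent_monomial_mult: "laurent_monomial f \<Longrightarrow> laurent_monomial g \<Longrightarrow> laurent_monomial (f * g)"
  by (auto simp: laurent_monomial_def mult_single)

lemma laurent_monomial_prod:
  assumes "\<And>i. i \<in> I \<Longrightarrow> laurent_monomial (f i)"
  shows "laurent_monomial (\<Prod>i\<in>I. f i)"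
proof -
  have "laurent_monomial 1" unfolding laurent_monomial_def by (metis single_one)
  then show ?thesis
    using assms by (induction I rule: infinite_finite_induct) (auto intro: laurent_monomial_mult)
qed

lemma laurent_monomial_vars:
  "laurent_monomial (xvar e)" "laurent_monomial (xinv e)" "laurent_monomial (yvar e)"
  by (auto simp: laurent_monomial_def xvar_def xinv_def yvar_def)

lemma nonneg_laurent_sum:
  assumes "\<And>i. i \<in> I \<Longrightarrow> laurent_monomial (f i)"
  shows "nonneg_laurent (\<Sum>i\<in>I. f i)"
proof -
  have "0 \<le> Poly_Mapping.lookup (f i) m" if "i \<in> I" for i m
    using assms[OF that] by (auto simp: laurent_monomial_def lookup_single when_def)
  then show ?thesis by (simp add: nonneg_laurent_def lookup_sum sum_nonneg)
qed

text \<open>Two opposite polynomials are both non-negative only if they vanish, so the description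
  in \<open>positive_sign\<close> is unique, also for zero.\<close>

lemma positive_sign_eq:
  assumes "f =\<^sub>\<plusminus> g" "nonneg_laurent g"
  shows "positive_sign f = g"
  unfolding positive_sign_def
proof (rule the_equality)
  show "(g = f \<or> g = - f) \<and> (\<forall>m. 0 \<le> Poly_Mapping.lookup g m)"
    using assms by (auto simp: eq_sign_def nonneg_laurent_def)
next
  fix h assume h: "(h = f \<or> h = - f) \<and> (\<forall>m. 0 \<le> Poly_Mapping.lookup h m)"
  show "h = g"
  proof (rule ccontr)
    assume "h \<noteq> g"
    then have "h = - g" using h assms(1) by (auto simp: eq_sign_def)
    then have "Poly_Mapping.lookup h m = - Poly_Mapping.lookup g m" for m by simp
    then have "Poly_Mapping.lookup h m = Poly_Mapping.lookup g m" for m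
      using h assms(2) unfolding nonneg_laurent_def by (smt (verit))
    then show False using \<open>h \<noteq> g\<close> poly_mapping_eqI by blast
  qed
qed

section \<open>Shear coordinates of principal laminations\<close>

lemma side_props:
  assumes "triangulated_surface T" "s \<in> sides T"
  shows cw_side: "cw T s \<in> sides T" and ccw_side: "ccw T s \<in> sides T"
    and cw_ccw: "cw T (ccw T s) = s" and ccw_cw: "ccw T (cw T s) = s"
    and cw_cw: "cw T (cw T s) = ccw T s" and ccw_ccw: "ccw T (ccw T s) = cw T s"
    and sides_distinct: "cw T s \<noteq> s" "ccw T s \<noteq> s" "cw T s \<noteq> ccw T s"
      "s \<noteq> cw T s" "s \<noteq> ccw T s" "ccw T s \<noteq> cw T s"
  using assms unfolding triangulated_surface_def ccw_def by metis+

lemma partner_unique: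
  assumes "triangulated_surface T" "s \<in> sides T" "s' \<in> sides T" "s' \<noteq> s" "edge T s' = edge T s"
    and "r \<in> sides T" "r \<noteq> s" "edge T r = edge T s"
  shows "r = s'"
proof (rule ccontr)
  assume "r \<noteq> s'"
  then have "card {s, s', r} = 3" using assms by auto
  moreover have "{s, s', r} \<subseteq> {t \<in> sides T. edge T t = edge T s}" using assms by auto
  moreover have "finite {t \<in> sides T. edge T t = edge T s}" and
    "card {t \<in> sides T. edge T t = edge T s} \<le> 2"
    using assms(1,2) by (auto simp: triangulated_surface_def)
  ultimately show False by (metis card_mono eval_nat_numeral(3) not_less_eq_eq)
qed

lemma partner_eq:
  assumes "triangulated_surface T" "s \<in> sides T" "s' \<in> sides T" "s' \<noteq> s" "edge T s' = edge T s"
  shows "partner T s = s'"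
  unfolding partner_def by (rule the_equality) (use assms in simp, elim conjE, rule partner_unique[OF assms])

lemma partner_props:
  assumes "triangulated_surface T" "inner T s"
  shows inner_side: "s \<in> sides T" and partner_side: "partner T s \<in> sides T"
    and partner_neq: "partner T s \<noteq> s" "s \<noteq> partner T s"
    and edge_partner: "edge T (partner T s) = edge T s"
    and inner_partner: "inner T (partner T s)" and partner_partner: "partner T (partner T s) = s"
proof -
  obtain s' where s': "s \<in> sides T" "s' \<in> sides T" "s' \<noteq> s" "edge T s' = edge T s"
    using assms(2) by (auto simp: inner_def)
  have "partner T s = s'" "partner T s' = s"
    using partner_eq[OF assms(1) s'] partner_eq[OF assms(1), of s' s] s' by auto
  moreover have "inner T s'" using s' by (auto simp: inner_def)
  ultimately show "s \<in> sides T" "partner T s \<in> sides T" "partner T s \<noteq> s" "s \<noteq> partner T s"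
    "edge T (partner T s) = edge T s" "inner T (partner T s)" "partner T (partner T s) = s"
    using s' by simp_all
qed

lemma lift_cross_lift_cross:
  "\<lbrakk>triangulated_surface T; inner T (fst \<sigma>)\<rbrakk> \<Longrightarrow> lift_cross T (lift_cross T \<sigma>) = \<sigma>"
  by (cases \<sigma>) (auto simp: partner_partner edge_partner)

lemma lift_cw_lift_ccw:
  "\<lbrakk>triangulated_surface T; fst \<sigma> \<in> sides T\<rbrakk> \<Longrightarrow> lift_cw T (lift_ccw T \<sigma>) = \<sigma>"
  "\<lbrakk>triangulated_surface T; fst \<sigma> \<in> sides T\<rbrakk> \<Longrightarrow> lift_ccw T \<sigma> \<noteq> lift_cw T \<sigma>"
  by (cases \<sigma>; auto simp: cw_ccw ccw_cw sides_distinct)+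

lemma deck_deck [simp]: "deck (deck \<sigma>) = \<sigma>"
  by (cases \<sigma>) simp

lemma lift_cw_deck: "lift_cw T (deck \<sigma>) = deck (lift_ccw T \<sigma>)"
  by (cases \<sigma>) simp

text \<open>The second conjunct makes right and left turns exclude each other, so that two
  consecutive turns in the same direction are neither an S- nor a Z-intersection.\<close>

definition turns_right :: "('s, 'e) triangulation \<Rightarrow> 's passage \<Rightarrow> bool" where
  "turns_right T p \<longleftrightarrow> endpoint_right T p \<and> \<not> endpoint_left T p"

definition turns_left :: "('s, 'e) triangulation \<Rightarrow> 's passage \<Rightarrow> bool" where
  "turns_left T p \<longleftrightarrow> endpoint_left T p \<and> \<not> endpoint_right T p"

lemma turns_right_fan:
  assumes "triangulated_surface T" "inner T (fst \<sigma>)"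
  shows "turns_right T (lift_cross T \<sigma>, fan_turn T \<sigma>)"
proof -
  have "fst (lift_cross T \<sigma>) \<in> sides T"
    using assms by (cases \<sigma>) (simp add: partner_side)
  then show ?thesis
    using lift_cw_lift_ccw[OF assms(1)]
    by (auto simp: turns_right_def endpoint_right_def endpoint_left_def fan_turn_def)
qed

lemma turns_left_swap: "turns_right T p \<Longrightarrow> turns_left T (prod.swap p)"
  by (cases p) (auto simp: turns_right_def turns_left_def endpoint_right_def endpoint_left_def)

lemma lift_cw_eq_iff:
  "\<lbrakk>triangulated_surface T; fst \<sigma> \<in> sides T; fst \<rho> \<in> sides T\<rbrakk> \<Longrightarrow>
    \<rho> = lift_cw T \<sigma> \<longleftrightarrow> \<sigma> = lift_ccw T \<rho>"
  by (cases \<sigma>; cases \<rho>) (auto simp: cw_ccw ccw_cw)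

lemma turns_deck:
  assumes "triangulated_surface T" "fst (fst p) \<in> sides T" "fst (snd p) \<in> sides T"
  shows "turns_left T (map_prod deck deck p) \<longleftrightarrow> turns_right T p"
    and "turns_right T (map_prod deck deck p) \<longleftrightarrow> turns_left T p"
proof -
  obtain \<rho> \<sigma> where p: "p = (\<rho>, \<sigma>)" by (cases p)
  have deck_eq: "deck x = deck y \<longleftrightarrow> x = y" for x y :: "'a lift_side"
    by (metis deck_deck)
  have "endpoint_left T (map_prod deck deck p) = endpoint_right T p"
    "endpoint_right T (map_prod deck deck p) = endpoint_left T p"
    using assms lift_cw_eq_iff[OF assms(1), of \<sigma> \<rho>] lift_cw_eq_iff[OF assms(1), of \<rho> \<sigma>] unfolding p
    by (auto simp: endpoint_left_def endpoint_right_def lift_cw_deck deck_eq)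
  then show "turns_left T (map_prod deck deck p) \<longleftrightarrow> turns_right T p"
    "turns_right T (map_prod deck deck p) \<longleftrightarrow> turns_left T p"
    by (auto simp: turns_left_def turns_right_def)
qed

lemma open_crossings_append:
  "\<lbrakk>xs \<noteq> []; ys \<noteq> []\<rbrakk> \<Longrightarrow>
    open_crossings (xs @ ys) = open_crossings xs @ (last xs, hd ys) # open_crossings ys"
proof (induction xs)
  case (Cons x xs)
  then show ?case
    by (cases xs; cases ys) (auto simp: open_crossings_def)
qed simp

lemma closed_crossings_append:
  assumes "xs \<noteq> []" "ys \<noteq> []"
  shows "closed_crossings (xs @ ys) =
    open_crossings xs @ (last xs, hd ys) # open_crossings ys @ [(last ys, hd xs)]"
proof -
  obtain x xs' where x: "xs = x # xs'" using assms by (cases xs) auto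
  have "zip (x # zs) (zs @ [y]) = zip (x # zs) zs @ [(last (x # zs), y)]" for zs y
    by (induction zs arbitrary: x) auto
  then have "closed_crossings (x # zs) = open_crossings (x # zs) @ [(last (x # zs), x)]" for zs
    by (simp add: closed_crossings_def open_crossings_def)
  from this[of "xs' @ ys"] show ?thesis
    using open_crossings_append[OF assms] assms x by simp
qed

lemma open_crossings_subset: "set (open_crossings ps) \<subseteq> set ps \<times> set ps"
  unfolding open_crossings_def by (cases ps) (auto dest: set_zip_leftD set_zip_rightD)

lemma no_intersection:
  assumes "(\<forall>p\<in>set ps. turns_left T p) \<or> (\<forall>p\<in>set ps. turns_right T p)"
  shows "filter (S_intersection T) (filter Q (open_crossings ps)) = []"
    and "filter (Z_intersection T) (filter Q (open_crossings ps)) = []"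
proof -
  have "\<not> S_intersection T c \<and> \<not> Z_intersection T c" if "c \<in> set (open_crossings ps)" for c
    using assms open_crossings_subset[of ps] that
    by (cases c) (auto simp: S_intersection_def Z_intersection_def turns_left_def turns_right_def)
  then show "filter (S_intersection T) (filter Q (open_crossings ps)) = []"
    "filter (Z_intersection T) (filter Q (open_crossings ps)) = []"
    by (simp_all add: filter_empty_conv)
qed

lemma S_intersection_turns:
  "turns_right T p \<Longrightarrow> turns_left T q \<Longrightarrow> S_intersection T (p, q) \<and> \<not> Z_intersection T (p, q)"
  and Z_intersection_turns:
  "turns_left T p \<Longrightarrow> turns_right T q \<Longrightarrow> Z_intersection T (p, q) \<and> \<not> S_intersection T (p, q)"
  by (auto simp: turns_left_def turns_right_def S_intersection_def Z_intersection_def)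

definition shear_count ::
    "('s, 'e) triangulation \<Rightarrow> ('s passage \<times> 's passage \<Rightarrow> bool) \<Rightarrow> ('s passage \<times> 's passage) list \<Rightarrow> int" where
  "shear_count T Q cs = int (length (filter (S_intersection T) (filter Q cs))) -
     int (length (filter (Z_intersection T) (filter Q cs)))"

lemma shear_count_append: "shear_count T Q (cs @ cs') = shear_count T Q cs + shear_count T Q cs'"
  by (simp add: shear_count_def)

lemma shear_count_one_turn:
  assumes "(\<forall>p\<in>set ps. turns_left T p) \<or> (\<forall>p\<in>set ps. turns_right T p)"
  shows "shear_count T Q (open_crossings ps) = 0"
  unfolding shear_count_def no_intersection[OF assms] by simp

lemma shear_count_left_right:
  assumes "xs \<noteq> []" "ys \<noteq> []" "\<forall>p\<in>set xs. turns_left T p" "\<forall>p\<in>set ys. turns_right T p"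
  shows "shear_count T Q [(last xs, hd ys)] = (if Q (last xs, hd ys) then -1 else 0)"
  using Z_intersection_turns[of T "last xs" "hd ys"] assms by (simp add: shear_count_def)

lemma shear_count_right_left:
  assumes "xs \<noteq> []" "ys \<noteq> []" "\<forall>p\<in>set xs. turns_right T p" "\<forall>p\<in>set ys. turns_left T p"
  shows "shear_count T Q [(last xs, hd ys)] = (if Q (last xs, hd ys) then 1 else 0)"
  using S_intersection_turns[of T "last xs" "hd ys"] assms by (simp add: shear_count_def)

text \<open>Flags and sides of the double cover are both a side with a Boolean. Under this
  identification circling a marked point is the same map, so \<open>unpunctured\<close> makes every
  fan end at the boundary.\<close>

lemma fan_turn_eq: "fan_turn T = corner_move T \<circ> cross_move T"
  by (auto simp: fan_turn_def fun_eq_iff)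

lemma fan_length_inner:
  assumes "k < fan_length T \<sigma>"
  shows "inner T (fst ((fan_turn T ^^ k) \<sigma>))"
  using not_less_Least[of k "\<lambda>n. \<not> inner T (fst ((fan_turn T ^^ n) \<sigma>))"] assms
  by (auto simp: fan_length_def)

lemma fan_length_pos:
  assumes "unpunctured T" "inner T (fst \<sigma>)"
  shows "0 < fan_length T \<sigma>"
proof -
  obtain n where "\<not> inner T (fst ((fan_turn T ^^ n) \<sigma>))"
    using assms unfolding unpunctured_def fan_turn_eq inner_def[of T "fst \<sigma>"] by (metis prod.collapse)
  then have "\<not> inner T (fst ((fan_turn T ^^ fan_length T \<sigma>) \<sigma>))"
    unfolding fan_length_def by (rule LeastI)
  then show ?thesis using assms(2) by (intro gr0I) auto
qed

lemma turns_right_fan_passages: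
  assumes "triangulated_surface T" "n \<le> fan_length T \<sigma>" "p \<in> set (fan_passages T \<sigma> n)"
  shows "turns_right T p \<and> fst (fst p) \<in> sides T \<and> fst (snd p) \<in> sides T"
proof -
  obtain k where k: "k < n" and p: "p = (lift_cross T ((fan_turn T ^^ k) \<sigma>), fan_turn T ((fan_turn T ^^ k) \<sigma>))"
    using assms(3) by (auto simp: fan_passages_def)
  have inn: "inner T (fst ((fan_turn T ^^ k) \<sigma>))" using fan_length_inner[of k T \<sigma>] k assms(2) by simp
  then show ?thesis
    using turns_right_fan[OF assms(1) inn] unfolding p
    by (cases "(fan_turn T ^^ k) \<sigma>") (auto simp: fan_turn_def partner_side cw_side ccw_side assms(1))
qed

lemma hd_fan_passages: "0 < n \<Longrightarrow> hd (fan_passages T \<sigma> n) = (lift_cross T \<sigma>, fan_turn T \<sigma>)"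
  by (simp add: fan_passages_def hd_map)

lemma last_fan_passages: "0 < n \<Longrightarrow> snd (last (fan_passages T \<sigma> n)) = (fan_turn T ^^ n) \<sigma>"
  by (cases n) (simp_all add: fan_passages_def last_map)

lemma fan_passages_Nil: "fan_passages T \<sigma> n = [] \<longleftrightarrow> n = 0"
  by (simp add: fan_passages_def)

lemma turns_map_deck:
  assumes "triangulated_surface T" "\<forall>p\<in>set ps. fst (fst p) \<in> sides T \<and> fst (snd p) \<in> sides T"
  shows "(\<forall>p\<in>set (map (map_prod deck deck) ps). turns_left T p) \<longleftrightarrow> (\<forall>p\<in>set ps. turns_right T p)"
    and "(\<forall>p\<in>set (map (map_prod deck deck) ps). turns_right T p) \<longleftrightarrow> (\<forall>p\<in>set ps. turns_left T p)"
  using assms turns_deck[OF assms(1)] by auto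

text \<open>Turning clockwise at both ends means turning left before the crossing of \<sigma> and
  right after it, with no other change of direction. So one lift has a single Z-intersection, at
  \<sigma>, and its deck image a single S-intersection, at \<open>deck \<sigma>\<close>. In the
  closed case both changes of direction occur on one curve.\<close>

lemma shear_count_lamination:
  assumes T: "triangulated_surface T" "unpunctured T" and inn: "inner T (fst \<sigma>)"
  shows "shear_count T (\<lambda>c. snd (fst c) \<in> A) (lamination_crossings T \<sigma>) =
    (if deck \<sigma> \<in> A then 1 else 0) - (if \<sigma> \<in> A then 1 else 0)"
proof (cases "self_intersecting T \<sigma>")
  case True
  define k where "k = (LEAST k. (fan_turn T ^^ k) \<sigma> = deck \<sigma>)"
  obtain k' where k': "k' \<le> fan_length T \<sigma>" "(fan_turn T ^^ k') \<sigma> = deck \<sigma>"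
    using True by (auto simp: self_intersecting_def)
  have k: "(fan_turn T ^^ k) \<sigma> = deck \<sigma>" "k \<le> fan_length T \<sigma>"
    unfolding k_def using k' by (auto intro: LeastI Least_le[THEN order_trans])
  have "\<sigma> \<noteq> deck \<sigma>" by (cases \<sigma>) simp
  then have "0 < k" using k by (intro gr0I) auto
  define ps where "ps = fan_passages T \<sigma> k"
  define qs where "qs = map (map_prod deck deck) ps"
  have ps: "ps \<noteq> []" "\<forall>p\<in>set ps. turns_right T p" and qs: "qs \<noteq> []" "\<forall>p\<in>set qs. turns_left T p"
    using \<open>0 < k\<close> turns_right_fan_passages[OF T(1) k(2)] turns_map_deck(1)[OF T(1), of ps]
    by (auto simp: ps_def qs_def fan_passages_Nil)
  have last: "snd (last ps) = deck \<sigma>" "snd (last qs) = \<sigma>"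
    using last_fan_passages[OF \<open>0 < k\<close>, of T \<sigma>] k ps by (auto simp: ps_def qs_def last_map)
  have "lamination_crossings T \<sigma> =
      open_crossings ps @ [(last ps, hd qs)] @ open_crossings qs @ [(last qs, hd ps)]"
    using True closed_crossings_append[OF ps(1) qs(1)]
    by (simp add: lamination_crossings_def closed_lamination_def half_closed_lamination_def ps_def qs_def k_def)
  then show ?thesis
    using ps(2) qs(2) last shear_count_left_right[OF qs(1) ps(1) qs(2) ps(2)]
      shear_count_right_left[OF ps(1) qs(1) ps(2) qs(2)]
    by (simp add: shear_count_append shear_count_one_turn del: append_Cons)
next
  case False
  let ?\<rho> = "lift_cross T \<sigma>"
  have inn': "inner T (fst ?\<rho>)" using inn T by (cases \<sigma>) (simp add: inner_partner)
  define ps where "ps = fan_passages T \<sigma> (fan_length T \<sigma>)"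
  define rs where "rs = fan_passages T ?\<rho> (fan_length T ?\<rho>)"
  define qs where "qs = rev (map prod.swap rs)"
  define ps' where "ps' = map (map_prod deck deck) ps"
  define qs' where "qs' = map (map_prod deck deck) qs"
  have nonempty: "ps \<noteq> []" "qs \<noteq> []" "ps' \<noteq> []" "qs' \<noteq> []"
    using fan_length_pos[OF T(2)] inn inn'
    by (auto simp: ps_def rs_def qs_def ps'_def qs'_def fan_passages_Nil)
  have p: "turns_right T p \<and> fst (fst p) \<in> sides T \<and> fst (snd p) \<in> sides T" if "p \<in> set ps" for p
    using turns_right_fan_passages[OF T(1) order_refl] that unfolding ps_def by blast
  have q: "turns_left T p \<and> fst (fst p) \<in> sides T \<and> fst (snd p) \<in> sides T" if "p \<in> set qs" for p
  proof -
    obtain r where "r \<in> set rs" "p = prod.swap r" using \<open>p \<in> set qs\<close> by (auto simp: qs_def)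
    then show ?thesis
      using turns_right_fan_passages[OF T(1) order_refl, of r ?\<rho>] turns_left_swap[of T r]
      by (simp add: rs_def)
  qed
  have turns: "\<forall>p\<in>set ps. turns_right T p" "\<forall>p\<in>set qs. turns_left T p"
    "\<forall>p\<in>set ps'. turns_left T p" "\<forall>p\<in>set qs'. turns_right T p"
    using p q turns_map_deck[OF T(1), of ps] turns_map_deck[OF T(1), of qs] by (auto simp: ps'_def qs'_def)
  have "last qs = prod.swap (hd rs)"
    using nonempty(2) by (auto simp: qs_def last_rev hd_map)
  moreover have "hd rs = (lift_cross T ?\<rho>, fan_turn T ?\<rho>)"
    unfolding rs_def by (rule hd_fan_passages[OF fan_length_pos[OF T(2) inn']])
  ultimately have last: "snd (last qs) = \<sigma>" using lift_cross_lift_cross[OF T(1) inn] by simp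
  then have last': "snd (last qs') = deck \<sigma>"
    using nonempty(2) by (simp add: qs'_def last_map)
  have "lamination_crossings T \<sigma> =
      (open_crossings qs @ [(last qs, hd ps)] @ open_crossings ps) @
      (open_crossings qs' @ [(last qs', hd ps')] @ open_crossings ps')"
    using False open_crossings_append[OF nonempty(2,1)] open_crossings_append[OF nonempty(4,3)]
    by (simp add: lamination_crossings_def open_lamination_def ps_def rs_def qs_def ps'_def qs'_def)
  then show ?thesis
    using turns last last' nonempty
      shear_count_left_right[OF nonempty(2,1) turns(2,1)] shear_count_right_left[OF nonempty(4,3) turns(4,3)]
    by (simp add: shear_count_append shear_count_one_turn del: append_Cons)
qed

lemma shear_props:
  assumes T: "triangulated_surface T" "unpunctured T" "principal_lamination T L" and inn: "inner T s"
  shows shear_values: "shear T L (s, u) = 1 \<or> shear T L (s, u) = -1"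
    and shear_flip: "shear T L (s, \<not> u) = - shear T L (s, u)"
    and shear_partner: "shear T L (partner T s, u \<noteq> twisted T (edge T s)) = shear T L (s, u)"
proof -
  let ?\<sigma> = "L (edge T s)"
  have "edge T s \<in> arcs T" using inn by (simp add: arcs_def)
  then have e: "fst ?\<sigma> \<in> sides T" "edge T (fst ?\<sigma>) = edge T s"
    using T(3) by (auto simp: principal_lamination_def)
  then have fst: "fst ?\<sigma> = s \<or> fst ?\<sigma> = partner T s"
    using partner_eq[OF T(1) inner_side[OF T(1) inn] e(1) _ e(2)] by metis
  then have "inner T (fst ?\<sigma>)" using inn inner_partner[OF T(1) inn] by auto
  note count = shear_count_lamination[OF T(1,2) this]
  \<comment> \<open>The chosen side belongs to one of the two lifts of the arc and its deck image to
    the other, so exactly one of the two indicators is 1.\<close>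
  have *: "shear T L \<tau> = (if deck ?\<sigma> \<in> {\<tau>, lift_cross T \<tau>} then 1 else 0) -
      (if ?\<sigma> \<in> {\<tau>, lift_cross T \<tau>} then 1 else 0)"
    if "edge T (fst \<tau>) = edge T s" for \<tau>
    using count[of "{\<tau>, lift_cross T \<tau>}"] that by (simp add: shear_def shear_count_def Let_def)
  show "shear T L (s, u) = 1 \<or> shear T L (s, u) = -1" "shear T L (s, \<not> u) = - shear T L (s, u)"
    using fst partner_neq[OF T(1) inn] by (cases ?\<sigma>; auto simp: *)+
  show "shear T L (partner T s, u \<noteq> twisted T (edge T s)) = shear T L (s, u)"
    using lift_cross_lift_cross[OF T(1), of "(s, u)"] inn edge_partner[OF T(1) inn]
    by (simp add: * insert_commute)
qed

section \<open>Matrices of paths\<close>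

lemma move_move:
  assumes "triangulated_surface T" "fst f \<in> sides T" "a = Cross \<longrightarrow> inner T (fst f)"
  shows "move T a (move T a f) = f"
  using assms
  by (cases a; cases f) (auto simp: cw_ccw ccw_cw partner_partner edge_partner)

lemma move_side:
  assumes "triangulated_surface T" "fst f \<in> sides T" "a = Cross \<longrightarrow> inner T (fst f)"
  shows "fst (move T a f) \<in> sides T" "a = Cross \<longrightarrow> inner T (fst (move T a f))"
  using assms
  by (cases a; cases f; auto simp: cw_side ccw_side partner_side inner_partner)+

lemma path_append:
  "path_matrix T L om f (ps @ qs) = path_matrix T L om (path_end T f ps) qs ** path_matrix T L om f ps"
  "path_end T f (ps @ qs) = path_end T (path_end T f ps) qs"
  "path_crossings T f (ps @ qs) = path_crossings T f ps @ path_crossings T (path_end T f ps) qs"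
  by (induction ps arbitrary: f) (simp_all add: matrix_mul_assoc matrix_mul_rid)

lemma path_valid_start: "path_valid T f ps \<Longrightarrow> fst f \<in> sides T"
  by (cases ps) auto

lemma path_valid_append:
  "path_valid T f (ps @ qs) \<longleftrightarrow> path_valid T f ps \<and> path_valid T (path_end T f ps) qs"
  by (induction ps arbitrary: f) (auto dest: path_valid_start)

section \<open>Crossing matrices and frames on triangles\<close>

locale laminated_surface =
  fixes T :: "('s, 'e) triangulation" and L :: "'e \<Rightarrow> 's lift_side"
  assumes T: "triangulated_surface T" "unpunctured T" and L: "principal_lamination T L"
begin

definition positive_crossing :: "'s flag \<Rightarrow> bool" where
  "positive_crossing f \<longleftrightarrow> shear T L f = 1"

definition crossing_matrix :: "'s flag \<Rightarrow> 'e laurent^2^2" where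
  "crossing_matrix f = (if positive_crossing f then mat2 1 0 0 (yvar (edge T (fst f)))
     else mat2 (yvar (edge T (fst f))) 0 0 1)"

lemma positive_crossing_flip: "inner T s \<Longrightarrow> positive_crossing (s, \<not> u) \<longleftrightarrow> \<not> positive_crossing (s, u)"
  using shear_values[OF T L, of s] shear_flip[OF T L, of s] by (auto simp: positive_crossing_def)

lemma positive_crossing_False:
  "inner T s \<Longrightarrow> positive_crossing (s, False) \<longleftrightarrow> \<not> positive_crossing (s, True)"
  using positive_crossing_flip[of s True] by simp

lemma positive_crossing_partner:
  "inner T s \<Longrightarrow> positive_crossing (partner T s, u) \<longleftrightarrow> positive_crossing (s, u \<noteq> twisted T (edge T s))"
  using shear_partner[OF T L, of s "u \<noteq> twisted T (edge T s)"]
  by (cases u; cases "twisted T (edge T s)") (simp_all add: positive_crossing_def)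

text \<open>Reversing \<open>om\<close> changes both the sense of the crossing and the sign of the
  shear coordinate, and these cancel. What decides is the end at which the arc is crossed, read as a
  local orientation.\<close>

lemma cross_matrix_eq:
  assumes "inner T (fst f)"
  shows "cross_matrix T L om f = crossing_matrix f"
proof -
  obtain s e where f: "f = (s, e)" by (cases f)
  have "shear T L (s, u) = -1 \<longleftrightarrow> \<not> positive_crossing (s, u)" for u
    using shear_values[OF T L, of s u] assms f by (auto simp: positive_crossing_def)
  moreover have "shear T L (s, u) = 1 \<longleftrightarrow> positive_crossing (s, u)" for u
    by (simp add: positive_crossing_def)
  ultimately show ?thesis
    using positive_crossing_False[of s] assms f
    by (cases e; cases "om (s, e)") (simp_all add: cross_matrix_def crossing_matrix_def Let_def)
qed

text \<open>Converts from the reference orientation to the one selected by \<open>u\<close>: up to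
  sign, step matrices for different orientations differ by such a factor at each end. When the
  orientation changes along a side a single nontrivial factor remains, which accounts for the
  matrices of steps through a crosscap.\<close>

definition orient_matrix :: "bool \<Rightarrow> 'e laurent^2^2" where
  "orient_matrix u = (if u then mat2 1 0 0 1 else mat2 1 0 0 (- 1))"

text \<open>
  A flat section over the triangle of \<open>b\<close>: its value at a flag is the matrix of a path
  from \<open>(b, True)\<close> to this flag, all orientations being those of the triangle.
\<close>

definition frame :: "'s \<Rightarrow> 's flag \<Rightarrow> 'e laurent^2^2" where
  "frame b f =
     (let x = xvar (edge T b); y = xvar (edge T (cw T b)); z = xvar (edge T (ccw T b));
          x' = xinv (edge T b); y' = xinv (edge T (cw T b)); z' = xinv (edge T (ccw T b))
      in if fst f = b then (if snd f then mat2 1 0 0 1 else mat2 0 (- x) x' 0)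
         else if fst f = cw T b
         then (if snd f then mat2 (z * x') (- y) y' 0 else mat2 1 0 (- (z * x' * y')) 1)
         else (if snd f then mat2 0 (- x) x' (- (y * z')) else mat2 (z * x') (- y) 0 (x * z')))"

text \<open>The six flags of a triangle form a hexagon of alternating corner and along steps. The
  product around it is plus or minus the identity, so \<open>frame\<close>, although defined by
  paths from one flag, is compatible with all its steps.\<close>

lemma frame_step:
  fixes om :: "'s flag \<Rightarrow> bool"
  assumes b: "b \<in> sides T" and f: "fst f \<in> triangle T b" and a: "a \<noteq> Cross"
    and om: "om (corner_move T f) = om f"
  shows "step_matrix T L om a f ** (orient_matrix (om f) ** frame b f) =\<^sub>\<plusminus>
    orient_matrix (om (move T a f)) ** frame b (move T a f)"
proof -
  define x1 y1 z1 where "x1 = xvar (edge T b)" and "y1 = xvar (edge T (cw T b))"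
    and "z1 = xvar (edge T (ccw T b))"
  define x2 y2 z2 where "x2 = xinv (edge T b)" and "y2 = xinv (edge T (cw T b))"
    and "z2 = xinv (edge T (ccw T b))"
  note defs = x1_def y1_def z1_def x2_def y2_def z2_def
  have inv: "x1 * x2 = 1" "y1 * y2 = 1" "z1 * z2 = 1" by (simp_all add: defs xvar_xinv)
  have inv': "x1 * (x2 * t) = t" "y1 * (y2 * t) = t" "z1 * (z2 * t) = t" for t
    using inv by (simp_all add: mult.assoc[symmetric])
  obtain s e where se: "f = (s, e)" by (cases f)
  note sides = cw_side[OF T(1) b] ccw_side[OF T(1) b] cw_ccw[OF T(1) b] ccw_cw[OF T(1) b]
    cw_cw[OF T(1) b] ccw_ccw[OF T(1) b] sides_distinct[OF T(1) b]
  have "s = b \<or> s = cw T b \<or> s = ccw T b" using f se by (auto simp: triangle_def)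
  moreover have "a = Corner \<or> a = Along" using a by (cases a) auto
  ultimately show ?thesis
    using om unfolding se
    by (elim disjE; cases e; cases "om (s, e)"; cases "om (along_move (s, e))")
      (simp_all add: sides frame_def orient_matrix_def corner_matrix_def along_matrix_def Let_def
        eq_sign_def mat2_eq_iff mult_ac algebra_simps inv inv' flip: defs)
qed

lemma orient_matrix_mult:
  "orient_matrix u ** orient_matrix v = orient_matrix (u = v)"
  "orient_matrix u ** (orient_matrix v ** M) = orient_matrix (u = v) ** M"
  by (simp_all add: orient_matrix_def matrix_mul_assoc)

lemma crossing_matrix_orient: "crossing_matrix f ** orient_matrix u = orient_matrix u ** crossing_matrix f"
  by (simp add: crossing_matrix_def orient_matrix_def)

lemma frame_step_reference:
  assumes "b \<in> sides T" "s \<in> triangle T b"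
  shows "along_matrix T (\<lambda>_. True) (s, e) ** frame b (s, e) =\<^sub>\<plusminus> frame b (s, \<not> e)"
proof -
  define \<theta> where "\<theta> = (\<lambda>f :: 's flag. True)"
  have "frame b f = orient_matrix True ** frame b f" for f
    by (simp add: orient_matrix_def matrix_mul_lid flip: mat_1_mat2)
  moreover have "along_matrix T \<theta> (s, e) ** (orient_matrix (\<theta> (s, e)) ** frame b (s, e)) =\<^sub>\<plusminus>
      orient_matrix (\<theta> (s, \<not> e)) ** frame b (s, \<not> e)"
    using frame_step[of b "(s, e)" Along \<theta>] assms by (simp add: \<theta>_def)
  ultimately show ?thesis by (simp add: \<theta>_def)
qed

text \<open>
  The end at which \<open>s\<close> is crossed is chosen such that the path arrives at \<open>(partner T s, True)\<close>.
\<close>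

definition cross_transfer :: "'s \<Rightarrow> 's \<Rightarrow> 'e laurent^2^2" where
  "cross_transfer p s =
     (let e = twisted T (edge T s)
      in orient_matrix (\<not> e) ** (crossing_matrix (s, e) ** frame p (s, e)))"

text \<open>An arc may be crossed near either end, and in the frames both crossings must give the
  same matrix. One slides along the arc to the preferred end: the along matrix is antidiagonal,
  hence exchanges diag(1, y) and diag(y, 1), and the sign of the crossing changes between the ends
  as well.\<close>

lemma frame_cross:
  fixes om :: "'s flag \<Rightarrow> bool"
  assumes s: "inner T (fst f)" and p: "p \<in> sides T" "fst f \<in> triangle T p"
    and om: "om (cross_move T f) = (om f \<noteq> twisted T (edge T (fst f)))"
  shows "step_matrix T L om Cross f ** (orient_matrix (om f) ** frame p f) =\<^sub>\<plusminus>
    orient_matrix (om (cross_move T f)) ** frame (partner T (fst f)) (cross_move T f) ** cross_transfer p (fst f)"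
proof -
  obtain r e where f: "f = (r, e)" by (cases f)
  let ?t = "twisted T (edge T r)"
  let ?A = "along_matrix T (\<lambda>_. True) (r, ?t)"
  have lhs: "step_matrix T L om Cross f ** (orient_matrix (om f) ** frame p f) =
      orient_matrix (om f) ** crossing_matrix f ** frame p f"
    using s by (simp add: cross_matrix_eq matrix_mul_assoc crossing_matrix_orient)
  show ?thesis
  proof (cases "e = ?t")
    case True
    then have "cross_move T f = (partner T r, True)" by (auto simp: f)
    moreover have "frame (partner T r) (partner T r, True) = mat 1" by (simp add: frame_def mat_1_mat2)
    moreover have "((om f \<noteq> ?t) = (\<not> ?t)) = om f" by auto
    ultimately show ?thesis
      unfolding lhs using om True
      by (simp add: f cross_transfer_def Let_def matrix_mul_rid orient_matrix_mult matrix_mul_assoc)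
  next
    case False
    then have e: "e = (\<not> ?t)" by auto
    have pc: "positive_crossing (r, False) \<longleftrightarrow> \<not> positive_crossing (r, True)"
      using positive_crossing_False s f by simp
    have edge_r: "edge T (partner T r) = edge T r" using edge_partner[OF T(1)] s f by simp
    have move: "cross_move T f = (partner T r, False)" using False by (auto simp: f)
    have "orient_matrix (om f) ** crossing_matrix f ** frame p f =\<^sub>\<plusminus>
        orient_matrix (om f) ** crossing_matrix f ** (?A ** frame p (r, ?t))"
      unfolding f e by (intro eq_sign_matrix_mult eq_sign_refl eq_sign_sym[OF frame_step_reference])
        (use p f in auto)
    also have "\<dots> = orient_matrix (om f) ** crossing_matrix f ** ?A ** frame p (r, ?t)"
      by (simp add: matrix_mul_assoc)
    also have "\<dots> =\<^sub>\<plusminus> orient_matrix (om f \<noteq> ?t) ** frame (partner T r) (partner T r, False) **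
        (orient_matrix (\<not> ?t) ** crossing_matrix (r, ?t)) ** frame p (r, ?t)"
      unfolding f e
      by (rule eq_sign_matrix_mult[OF _ eq_sign_refl]; cases "om (r, e)"; cases ?t; cases "positive_crossing (r, True)")
        (simp_all add: pc edge_r orient_matrix_def crossing_matrix_def frame_def along_matrix_def Let_def
          eq_sign_def mat2_eq_iff e)
    also have "\<dots> = orient_matrix (om (cross_move T f)) ** frame (partner T (fst f)) (cross_move T f) **
        cross_transfer p (fst f)"
      using om unfolding move by (simp add: f cross_transfer_def Let_def matrix_mul_assoc)
    finally show ?thesis unfolding lhs .
  qed
qed

section \<open>Holonomy of a sequence of crossings\<close>

primrec transfer :: "'s \<Rightarrow> 's list \<Rightarrow> 'e laurent^2^2" where
  "transfer p [] = mat 1"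
| "transfer p (s # cs) = transfer (partner T s) cs ** cross_transfer p s"

definition last_partner :: "'s \<Rightarrow> 's list \<Rightarrow> 's" where
  "last_partner p cs = (if cs = [] then p else partner T (last cs))"

lemma last_partner_simps [simp]:
  "last_partner p [] = p" "last_partner p (s # cs) = last_partner (partner T s) cs"
  "last_partner p (cs @ [s]) = partner T s"
  by (simp_all add: last_partner_def)

lemma transfer_append: "transfer p (cs @ [s]) = cross_transfer (last_partner p cs) s ** transfer p cs"
  by (induction cs arbitrary: p) (simp_all add: matrix_mul_assoc matrix_mul_lid matrix_mul_rid)

lemma triangle_refl: "s \<in> triangle T s"
  by (simp add: triangle_def)

lemma move_triangle:
  assumes "b \<in> sides T" "fst f \<in> triangle T b" "a \<noteq> Cross"
  shows "fst (move T a f) \<in> triangle T b"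
  using assms cw_ccw[OF T(1)] ccw_cw[OF T(1)] cw_cw[OF T(1)] ccw_ccw[OF T(1)]
  by (cases a; cases f) (auto simp: triangle_def)

end

locale oriented_laminated_surface = laminated_surface T L
  for T :: "('s, 'e) triangulation" and L :: "'e \<Rightarrow> 's lift_side" +
  fixes om :: "'s flag \<Rightarrow> bool"
  assumes om: "point_orientations T om"
begin

text \<open>Inside a triangle the frames absorb all steps, so only crossings contribute. The base
  side \<open>p\<close> varies in the induction because each crossing moves the frame to the side
  just entered.\<close>

lemma path_matrix_frame:
  assumes "path_valid T f ps" "p \<in> sides T" "fst f \<in> triangle T p"
  shows "path_matrix T L om f ps ** (orient_matrix (om f) ** frame p f) =\<^sub>\<plusminus>
      orient_matrix (om (path_end T f ps)) ** frame (last_partner p (path_crossings T f ps)) (path_end T f ps) **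
      transfer p (path_crossings T f ps) \<and>
    fst (path_end T f ps) \<in> triangle T (last_partner p (path_crossings T f ps))"
  using assms
proof (induction ps arbitrary: f p)
  case Nil
  then show ?case by (simp add: matrix_mul_lid matrix_mul_rid)
next
  case (Cons a ps)
  let ?s = "fst f" and ?F = "\<lambda>p f. orient_matrix (om f) ** frame p f"
  have side: "?s \<in> sides T" and valid: "path_valid T (move T a f) ps" using Cons.prems by auto
  have Cons_matrix: "path_matrix T L om f (a # ps) ** M =
      path_matrix T L om (move T a f) ps ** (step_matrix T L om a f ** M)" for M
    by (simp add: matrix_mul_assoc)
  show ?case
  proof (cases "a = Cross")
    case True
    then have s: "inner T ?s" using Cons.prems by simp
    note p' = partner_side[OF T(1) s]
    have tri: "fst (move T a f) \<in> triangle T (partner T ?s)" by (cases f) (simp add: True triangle_refl)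
    note IH = Cons.IH[OF valid p' tri]
    have "om (cross_move T f) = (om f \<noteq> twisted T (edge T ?s))"
      using om s unfolding point_orientations_def by (metis prod.collapse)
    then have "step_matrix T L om a f ** ?F p f =\<^sub>\<plusminus> ?F (partner T ?s) (move T a f) ** cross_transfer p ?s"
      unfolding True move.simps by (rule frame_cross[OF s Cons.prems(2,3)])
    then have "path_matrix T L om f (a # ps) ** ?F p f =\<^sub>\<plusminus>
        path_matrix T L om (move T a f) ps ** (?F (partner T ?s) (move T a f) ** cross_transfer p ?s)"
      unfolding Cons_matrix by (rule eq_sign_matrix_mult[OF eq_sign_refl])
    also have "\<dots> = path_matrix T L om (move T a f) ps ** ?F (partner T ?s) (move T a f) ** cross_transfer p ?s"
      by (simp add: matrix_mul_assoc)
    also have "\<dots> =\<^sub>\<plusminus> ?F (last_partner (partner T ?s) (path_crossings T (move T a f) ps)) (path_end T (move T a f) ps) **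
        transfer (partner T ?s) (path_crossings T (move T a f) ps) ** cross_transfer p ?s"
      by (rule eq_sign_matrix_mult[OF conjunct1[OF IH] eq_sign_refl])
    finally show ?thesis
      using conjunct2[OF IH] True by (simp add: matrix_mul_assoc)
  next
    case False
    have "om (corner_move T f) = om f"
      using om side unfolding point_orientations_def by (metis prod.collapse)
    then have "step_matrix T L om a f ** ?F p f =\<^sub>\<plusminus> ?F p (move T a f)"
      by (rule frame_step[OF Cons.prems(2,3) False])
    then have "path_matrix T L om f (a # ps) ** ?F p f =\<^sub>\<plusminus>
        path_matrix T L om (move T a f) ps ** ?F p (move T a f)"
      unfolding Cons_matrix by (rule eq_sign_matrix_mult[OF eq_sign_refl])
    also note conjunct1[OF Cons.IH[OF valid Cons.prems(2) move_triangle[OF Cons.prems(2,3) False]]]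
    finally show ?thesis
      using Cons.IH[OF valid Cons.prems(2) move_triangle[OF Cons.prems(2,3) False]] False by simp
  qed
qed

text \<open>Unlike crossing matrices, frames have determinant 1, so their adjugates are
  inverses.\<close>

lemma frame_invertible:
  assumes "b \<in> sides T"
  obtains F where "orient_matrix u ** frame b f ** F = mat 1" "F ** (orient_matrix u ** frame b f) = mat 1"
proof
  have inv: "xvar e * (xinv e * t) = t" for e :: 'e and t
    by (simp add: mult.assoc[symmetric] xvar_xinv)
  have det: "frame b f ** adj2 (frame b f) = mat 1 \<and> adj2 (frame b f) ** frame b f = mat 1"
    by (auto simp: frame_def mat_1_mat2 Let_def mat2_eq_iff xvar_xinv inv mult_ac)
  have orient: "orient_matrix u ** orient_matrix u = mat 1"
    by (simp add: orient_matrix_def mat_1_mat2)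
  have "orient_matrix u ** frame b f ** (adj2 (frame b f) ** orient_matrix u) =
      orient_matrix u ** (frame b f ** adj2 (frame b f)) ** orient_matrix u"
    by (simp only: matrix_mul_assoc[symmetric])
  then show "orient_matrix u ** frame b f ** (adj2 (frame b f) ** orient_matrix u) = mat 1"
    using det orient by (simp add: matrix_mul_rid)
  have "adj2 (frame b f) ** orient_matrix u ** (orient_matrix u ** frame b f) =
      adj2 (frame b f) ** (orient_matrix u ** orient_matrix u) ** frame b f"
    by (simp only: matrix_mul_assoc[symmetric])
  then show "adj2 (frame b f) ** orient_matrix u ** (orient_matrix u ** frame b f) = mat 1"
    using det orient by (simp add: matrix_mul_rid)
qed

lemma closed_path_trace:
  assumes valid: "path_valid T f ps" and closed: "path_end T f ps = f"
    and cs: "path_crossings T f ps = cs" "cs \<noteq> []" "partner T (last cs) \<in> sides T"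
  shows "trace (path_matrix T L om f ps) =\<^sub>\<plusminus> trace (transfer (partner T (last cs)) cs)"
proof -
  let ?p = "partner T (last cs)"
  have lp: "last_partner p cs = ?p" for p using cs(2) by (simp add: last_partner_def)
  \<comment> \<open>This instance, based at \<open>fst f\<close>, locates the flag: the path ends,
    and hence also starts, in the triangle entered by the last crossing. The frame of that triangle
    then serves at both ends.\<close>
  have "fst f \<in> triangle T ?p"
    using path_matrix_frame[OF valid path_valid_start[OF valid] triangle_refl] closed cs lp by simp
  then have eq: "path_matrix T L om f ps ** (orient_matrix (om f) ** frame ?p f) =\<^sub>\<plusminus>
      orient_matrix (om f) ** frame ?p f ** transfer ?p cs"
    using path_matrix_frame[OF valid cs(3)] closed cs lp by simp
  obtain F where F: "orient_matrix (om f) ** frame ?p f ** F = mat 1"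
    "F ** (orient_matrix (om f) ** frame ?p f) = mat 1"
    using frame_invertible[OF cs(3)] by metis
  have "path_matrix T L om f ps = path_matrix T L om f ps ** (orient_matrix (om f) ** frame ?p f) ** F"
    using F(1) by (simp add: matrix_mul_assoc[symmetric] matrix_mul_rid)
  also have "\<dots> =\<^sub>\<plusminus> orient_matrix (om f) ** frame ?p f ** transfer ?p cs ** F"
    by (rule eq_sign_matrix_mult[OF eq eq_sign_refl])
  finally have "trace (path_matrix T L om f ps) =\<^sub>\<plusminus>
      trace (orient_matrix (om f) ** frame ?p f ** transfer ?p cs ** F)"
    by (rule eq_sign_trace)
  also have "trace (orient_matrix (om f) ** frame ?p f ** transfer ?p cs ** F) =
      trace (F ** (orient_matrix (om f) ** frame ?p f) ** transfer ?p cs)"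
    by (subst trace_mul_sym) (simp add: matrix_mul_assoc)
  finally show ?thesis by (simp add: F(2) matrix_mul_lid)
qed

lemma trace_transfer_rotate1:
  "trace (transfer (partner T (last (rotate1 cs))) (rotate1 cs)) = trace (transfer (partner T (last cs)) cs)"
proof (cases cs)
  case (Cons s cs')
  have "last_partner (partner T s) cs' = partner T (last cs)"
    by (simp add: Cons last_partner_def)
  then show ?thesis
    by (auto simp: Cons transfer_append intro: trace_mul_sym)
qed simp

lemma trace_transfer_rotate:
  "trace (transfer (partner T (last (rotate n cs))) (rotate n cs)) = trace (transfer (partner T (last cs)) cs)"
proof (induction n)
  case (Suc n)
  then show ?case using trace_transfer_rotate1[of "rotate n cs"] by simp
qed simp

end

section \<open>Reversal of paths\<close>

context oriented_laminated_surface
begin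

text \<open>Corner and along steps are reversed by inversion up to sign, a crossing by exchanging
  its two diagonal entries; the adjugate does both. The sign is needed for steps through a crosscap,
  whose determinant is -1.\<close>

lemma step_matrix_reverse:
  assumes f: "fst f \<in> sides T" "a = Cross \<longrightarrow> inner T (fst f)"
  shows "step_matrix T L om a (move T a f) =\<^sub>\<plusminus> adj2 (step_matrix T L om a f)"
proof (cases a)
  case Corner
  obtain s e where se: "f = (s, e)" by (cases f)
  have "om (corner_move T (s, e)) = om (s, e)" using om f se by (simp add: point_orientations_def)
  then show ?thesis
    using f Corner se
    by (cases e) (auto simp: corner_matrix_def Let_def eq_sign_def mat2_eq_iff mult_ac cw_ccw[OF T(1)]
        ccw_cw[OF T(1)] cw_cw[OF T(1)] ccw_ccw[OF T(1)])
next
  case Cross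
  obtain s e where se: "f = (s, e)" by (cases f)
  have s: "inner T s" using f Cross se by simp
  show ?thesis
    using s positive_crossing_partner[OF s] positive_crossing_False[OF s] Cross
      inner_partner[OF T(1) s] edge_partner[OF T(1) s] unfolding se
    by (cases e; cases "twisted T (edge T s)")
      (auto simp: cross_matrix_eq crossing_matrix_def eq_sign_def mat2_eq_iff)
next
  case Along
  obtain s e where se: "f = (s, e)" by (cases f)
  show ?thesis
    unfolding Along se
    by (cases e; cases "om (s, True)"; cases "om (s, False)")
      (auto simp: along_matrix_def Let_def eq_sign_def mat2_eq_iff)
qed

lemma reverse_path:
  assumes "path_valid T f ps"
  shows "path_valid T (path_end T f ps) (rev ps) \<and> path_end T (path_end T f ps) (rev ps) = f \<and>
    path_crossings T (path_end T f ps) (rev ps) = rev (map (partner T) (path_crossings T f ps)) \<and>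
    path_matrix T L om (path_end T f ps) (rev ps) =\<^sub>\<plusminus> adj2 (path_matrix T L om f ps)"
  using assms
proof (induction ps arbitrary: f)
  case Nil
  then show ?case by (simp add: adj2_mat_1)
next
  case (Cons a ps)
  let ?f = "move T a f"
  have f: "fst f \<in> sides T" "a = Cross \<longrightarrow> inner T (fst f)" using Cons.prems by auto
  note IH = Cons.IH[of ?f] and move = move_move[OF T(1) f] and side = move_side[OF T(1) f]
  have IH: "path_valid T (path_end T ?f ps) (rev ps)" "path_end T (path_end T ?f ps) (rev ps) = ?f"
    "path_crossings T (path_end T ?f ps) (rev ps) = rev (map (partner T) (path_crossings T ?f ps))"
    "path_matrix T L om (path_end T ?f ps) (rev ps) =\<^sub>\<plusminus> adj2 (path_matrix T L om ?f ps)"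
    using Cons.IH[of ?f] Cons.prems by auto
  have "path_matrix T L om (path_end T ?f ps) (rev ps @ [a]) =\<^sub>\<plusminus>
      adj2 (step_matrix T L om a f) ** adj2 (path_matrix T L om ?f ps)"
    using eq_sign_matrix_mult[OF step_matrix_reverse[OF f] IH(4)]
    by (simp add: path_append IH matrix_mul_lid)
  moreover have "a = Cross \<Longrightarrow> fst ?f = partner T (fst f)" by (cases f) simp
  ultimately show ?case
    using IH f side move by (simp add: path_append path_valid_append adj2_mult)
qed

end

section \<open>Paths with prescribed crossings\<close>

context laminated_surface
begin

lemma triangle_path:
  assumes s: "s \<in> sides T" and s': "s' \<in> triangle T s"
  shows "\<exists>ps. path_valid T (s, e) ps \<and> path_end T (s, e) ps = (s', e') \<and> path_crossings T (s, e) ps = []"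
proof -
  define qs where "qs = (if s' = s then [] else if s' = cw T s then [Corner, Along]
    else [Corner, Along, Corner, Along])"
  have "path_valid T (s, True) qs \<and> path_end T (s, True) qs = (s', True) \<and> path_crossings T (s, True) qs = []"
    using s s' by (auto simp: qs_def triangle_def cw_side[OF T(1)] ccw_side[OF T(1)] cw_cw[OF T(1)])
  then show ?thesis
    using s s'
    by (intro exI[of _ "(if e then [] else [Along]) @ qs @ (if e' then [] else [Along])"])
      (auto simp: path_append path_valid_append triangle_def cw_side[OF T(1)] ccw_side[OF T(1)])
qed

primrec crossing_chain :: "'s \<Rightarrow> 's list \<Rightarrow> bool" where
  "crossing_chain p [] \<longleftrightarrow> True"
| "crossing_chain p (s # w) \<longleftrightarrow> inner T s \<and> s \<in> triangle T p \<and> crossing_chain (partner T s) w"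

lemma crossing_chain_path:
  assumes "p \<in> sides T" "crossing_chain p w"
  shows "\<exists>ps. path_valid T (p, True) ps \<and> path_end T (p, True) ps = (last_partner p w, True) \<and>
    path_crossings T (p, True) ps = w"
  using assms
proof (induction w arbitrary: p)
  case Nil
  then show ?case by (intro exI[of _ "[]"]) simp
next
  case (Cons s w)
  then have s: "inner T s" "s \<in> triangle T p" "crossing_chain (partner T s) w" by auto
  \<comment> \<open>This end of \<open>s\<close> is the one from which the crossing arrives at
    \<open>(partner T s, True)\<close>, where the induction hypothesis starts.\<close>
  obtain ps where ps: "path_valid T (p, True) ps" "path_end T (p, True) ps = (s, twisted T (edge T s))"
    "path_crossings T (p, True) ps = []"
    using triangle_path[OF Cons.prems(1) s(2)] by metis
  obtain qs where qs: "path_valid T (partner T s, True) qs"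
    "path_end T (partner T s, True) qs = (last_partner (partner T s) w, True)"
    "path_crossings T (partner T s, True) qs = w"
    using Cons.IH[OF partner_side[OF T(1) s(1)] s(3)] by metis
  show ?case
    using ps qs s inner_side[OF T(1) s(1)]
    by (intro exI[of _ "ps @ Cross # qs"]) (simp add: path_append path_valid_append)
qed

lemma crossing_chain_nth:
  assumes "\<And>k. k < length w \<Longrightarrow> inner T (w ! k) \<and> w ! k \<in> triangle T ((p # map (partner T) w) ! k)"
  shows "crossing_chain p w"
  using assms
proof (induction w arbitrary: p)
  case (Cons s w)
  have "crossing_chain (partner T s) w"
  proof (rule Cons.IH)
    fix k assume "k < length w"
    then show "inner T (w ! k) \<and> w ! k \<in> triangle T ((partner T s # map (partner T) w) ! k)"
      using Cons.prems[of "Suc k"] by simp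
  qed
  then show ?case using Cons.prems[of 0] by simp
qed simp

lemma closed_curve_chain:
  assumes "closed_curve T w"
  shows "crossing_chain (partner T (last w)) w"
proof (rule crossing_chain_nth)
  fix k assume k: "k < length w"
  have "w ! k \<in> triangle T ((partner T (last w) # map (partner T) w) ! k)"
  proof (cases k)
    case 0
    then have "w ! 0 \<in> triangle T (partner T (w ! (length w - 1)))"
      using assms k unfolding closed_curve_def by (metis Suc_diff_1 diff_less mod_self zero_less_one)
    moreover have "w \<noteq> []" using k by auto
    ultimately show ?thesis using 0 by (simp add: last_conv_nth)
  next
    case (Suc j)
    then have "j < length w" using k by simp
    then have "w ! (Suc j mod length w) \<in> triangle T (partner T (w ! j))"
      using assms unfolding closed_curve_def by blast
    then show ?thesis using Suc k by simp
  qed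
  then show "inner T (w ! k) \<and> w ! k \<in> triangle T ((partner T (last w) # map (partner T) w) ! k)"
    using assms k by (simp add: closed_curve_def)
qed

end

context oriented_laminated_surface
begin

lemma M_path_exists:
  assumes "closed_curve T w" "w \<noteq> []"
  shows "\<exists>\<rho>. M_path T w \<rho>"
proof -
  let ?p = "partner T (last w)"
  have "?p \<in> sides T" using assms by (intro partner_side[OF T(1)]) (simp add: closed_curve_def)
  then obtain ps where "path_valid T (?p, True) ps" "path_end T (?p, True) ps = (?p, True)"
    "path_crossings T (?p, True) ps = w"
    using crossing_chain_path[OF _ closed_curve_chain[OF assms(1)]] assms(2)
    by (auto simp: last_partner_def)
  then show ?thesis
    by (intro exI[of _ "((?p, True), ps)"]) (auto simp: M_path_def intro!: exI[of _ 0])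
qed

text \<open>A path in the opposite direction is reversed first: its matrix becomes the adjugate up
  to sign, which has the same trace, and its crossings become a rotation of
  \<open>w\<close>.\<close>

lemma M_path_trace:
  assumes w: "closed_curve T w" "w \<noteq> []" and \<rho>: "M_path T w (f, ps)"
  shows "trace (path_matrix T L om f ps) =\<^sub>\<plusminus> trace (transfer (partner T (last w)) w)"
proof -
  have inner: "inner T s" if "s \<in> set w" for s using w that by (simp add: closed_curve_def)
  have direct: "trace (path_matrix T L om f ps) =\<^sub>\<plusminus> trace (transfer (partner T (last w)) w)"
    if "path_valid T f ps" "path_end T f ps = f" "path_crossings T f ps = rotate n w" for f ps n
  proof -
    have "last (rotate n w) \<in> set w" using w(2) by (metis last_in_set rotate_is_Nil_conv set_rotate)
    then have "partner T (last (rotate n w)) \<in> sides T" using partner_side[OF T(1)] inner by simp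
    then show ?thesis
      using closed_path_trace[OF that] w(2) trace_transfer_rotate[of n w] by simp
  qed
  show ?thesis
  proof (cases "\<exists>n. path_crossings T f ps = rotate n w")
    case True
    then obtain n where "path_crossings T f ps = rotate n w" by blast
    then show ?thesis using direct[of f ps n] \<rho> by (simp add: M_path_def)
  next
    case False
    then obtain n where n: "path_crossings T f ps = rotate n (rev (map (partner T) w))"
      and valid: "path_valid T f ps" and closed: "path_end T f ps = f"
      using \<rho> by (auto simp: M_path_def)
    have "rev (map (partner T) (path_crossings T f ps)) = rev (map (partner T \<circ> partner T) (rotate n (rev w)))"
      by (simp add: n rotate_map rev_map)
    also have "map (partner T \<circ> partner T) (rotate n (rev w)) = rotate n (rev w)"
      by (rule map_idI) (simp add: partner_partner[OF T(1) inner])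
    also have "rev (rotate n (rev w)) = rotate (length w - n mod length w) w"
      by (simp add: rotate_rev)
    finally have "trace (path_matrix T L om f (rev ps)) =\<^sub>\<plusminus> trace (transfer (partner T (last w)) w)"
      using reverse_path[OF valid] closed direct by simp
    moreover have "trace (path_matrix T L om f (rev ps)) =\<^sub>\<plusminus> trace (path_matrix T L om f ps)"
      using eq_sign_trace[of "path_matrix T L om f (rev ps)" "adj2 (path_matrix T L om f ps)"]
        reverse_path[OF valid] closed
      by (simp add: trace_adj2)
    ultimately show ?thesis using eq_sign_sym eq_sign_trans by blast
  qed
qed

end

section \<open>One-sided closed curves\<close>

text \<open>
  Base change from the flag \<open>(p, True)\<close>, where the side \<open>p\<close> with label \<open>e\<close> has been crossed inwards, to the
  end of \<open>p\<close> on the right of the curve for the local orientation \<open>u\<close>, followed by the scaling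
  \<open>diag(1, x\<^sub>e)\<close>, which clears the denominators of the transition matrices.
\<close>

definition normalizer :: "bool \<Rightarrow> 'e \<Rightarrow> 'e laurent^2^2" where
  "normalizer u e = (if u then mat2 0 (xvar e) (- 1) 0 else mat2 1 0 0 (- xvar e))"

definition normalizer_inv :: "bool \<Rightarrow> 'e \<Rightarrow> 'e laurent^2^2" where
  "normalizer_inv u e = (if u then mat2 0 (- 1) (xinv e) 0 else mat2 1 0 0 (- xinv e))"

definition scalar_matrix :: "'a::comm_ring_1 \<Rightarrow> 'a^2^2" where
  "scalar_matrix c = mat2 c 0 0 c"

text \<open>The nonzero entries are the labels of the three snake graph edges between the levels of
  consecutive tiles; 0 belongs to the pair of vertices joined by no edge. Columns refer to the
  earlier tile, rows to the later one.\<close>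

definition turn_matrix :: "bool \<Rightarrow> 'e \<Rightarrow> 'e \<Rightarrow> 'e \<Rightarrow> 'e laurent^2^2" where
  "turn_matrix left e a e' =
     (if left then mat2 (xvar e) 0 (xvar a) (xvar e') else mat2 (xvar e') (xvar a) 0 (xvar e))"

lemma scalar_matrix_mult: "scalar_matrix c ** scalar_matrix d = scalar_matrix (c * d)"
  by (simp add: scalar_matrix_def)

lemma scalar_matrix_commute: "M ** scalar_matrix c = scalar_matrix c ** M"
  by (cases M rule: mat2_cases) (simp add: scalar_matrix_def mat2_eq_iff mult.commute)

lemma trace_scalar: "trace (scalar_matrix c ** M) = c * trace M"
  by (cases M rule: mat2_cases) (simp add: scalar_matrix_def trace_mat2 distrib_left)

lemma normalizer_normalizer_inv:
  "normalizer_inv u e ** normalizer u e = mat 1"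
  "normalizer u e ** normalizer_inv (\<not> u) e = mat2 0 (- 1) (- 1) 0"
  by (simp_all add: normalizer_def normalizer_inv_def mat_1_mat2 xvar_xinv)

context laminated_surface
begin

text \<open>With the frame placed on the right of the curve, the entries of each transition have a
  common sign. Multiplying by the variable of the entered side removes the denominator.\<close>

lemma cross_transfer_normal:
  assumes p: "p \<in> sides T" and s: "inner T s" "s = cw T p \<or> s = ccw T p"
  shows "normalizer (u \<noteq> twisted T (edge T s)) (edge T s) ** cross_transfer p s ** scalar_matrix (xvar (edge T p)) =\<^sub>\<plusminus>
    crossing_matrix (s, u) **
    turn_matrix ((s = ccw T p) = u) (edge T p) (edge T (if s = ccw T p then cw T p else ccw T p)) (edge T s) **
    normalizer u (edge T p)"
proof -
  define x1 y1 z1 where "x1 = xvar (edge T p)" and "y1 = xvar (edge T (cw T p))"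
    and "z1 = xvar (edge T (ccw T p))"
  define x2 y2 z2 where "x2 = xinv (edge T p)" and "y2 = xinv (edge T (cw T p))"
    and "z2 = xinv (edge T (ccw T p))"
  note defs = x1_def y1_def z1_def x2_def y2_def z2_def
  have inv: "x1 * x2 = 1" "y1 * y2 = 1" "z1 * z2 = 1" by (simp_all add: defs xvar_xinv)
  have inv': "x1 * (x2 * t) = t" "y1 * (y2 * t) = t" "z1 * (z2 * t) = t" for t
    using inv by (simp_all add: mult.assoc[symmetric])
  note sides = sides_distinct[OF T(1) p]
  show ?thesis
    using s(2) positive_crossing_False[OF s(1)]
    by (elim disjE; cases u; cases "twisted T (edge T s)"; cases "positive_crossing (s, True)")
      (simp_all add: sides frame_def orient_matrix_def crossing_matrix_def cross_transfer_def
        normalizer_def turn_matrix_def scalar_matrix_def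
        Let_def eq_sign_def mat2_eq_iff mult_ac algebra_simps inv inv' flip: defs)
qed

end

section \<open>Rotation, reduction and transport of closed curves\<close>

lemma closed_curve_rotate:
  assumes "closed_curve T w"
  shows "closed_curve T (rotate n w)"
  unfolding closed_curve_def
proof (intro conjI allI impI)
  show "\<forall>s\<in>set (rotate n w). inner T s" using assms by (simp add: closed_curve_def)
  fix k assume k: "k < length (rotate n w)"
  then have d: "0 < length w" by auto
  have "w ! (Suc ((n + k) mod length w) mod length w) \<in> triangle T (partner T (w ! ((n + k) mod length w)))"
    using assms d by (simp add: closed_curve_def)
  then show "rotate n w ! (Suc k mod length (rotate n w)) \<in> triangle T (partner T (rotate n w ! k))"
    using k d by (simp add: nth_rotate mod_simps)
qed

lemma homotopic_rotate:
  assumes "closed_curve T w"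
  shows "homotopic_curves T w (rotate n w)"
proof (induction n)
  case 0
  then show ?case using assms by (simp add: homotopic_curves.refl)
next
  case (Suc n)
  have "homotopic_curves T (rotate n w) (rotate1 (rotate n w))"
    using closed_curve_rotate[OF assms, of n]
    by (cases "rotate n w") (auto intro: homotopic_curves.refl homotopic_curves.rotate)
  with Suc show ?case by (auto intro: homotopic_curves.trans)
qed

text \<open>A backtracking, even across the base point, can be rotated to the front and cancelled,
  which shortens the curve. A curve with a single crossing cannot backtrack because the two sides of
  an arc are distinct.\<close>

lemma minimal_crossings_reduced:
  assumes T: "triangulated_surface T" and w: "closed_curve T w" "minimal_crossings T w" and k: "k < length w"
  shows "w ! (Suc k mod length w) \<noteq> partner T (w ! k)"
proof
  assume eq: "w ! (Suc k mod length w) = partner T (w ! k)"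
  have "inner T (w ! k)" using w k by (simp add: closed_curve_def)
  then have neq: "w ! k \<noteq> partner T (w ! k)" using partner_neq[OF T] by blast
  have "length w \<noteq> 1"
  proof
    assume "length w = 1"
    then have "Suc k mod length w = k" using k by simp
    then show False using eq neq by simp
  qed
  then have d: "2 \<le> length w" using k by linarith
  then have "Suc (Suc 0) \<le> length (rotate k w)" by simp
  then obtain a b v where abv: "rotate k w = a # b # v" unfolding Suc_le_length_iff by blast
  have "rotate k w ! 0 = w ! k" "rotate k w ! 1 = partner T (w ! k)"
    using nth_rotate[of 0 w k] nth_rotate[of 1 w k] d k eq by (auto simp flip: length_greater_0_conv)
  then have v: "rotate k w = w ! k # partner T (w ! k) # v" using abv by simp
  then have "homotopic_curves T (rotate k w) v"
    using homotopic_curves.cancel[of T "w ! k" v] closed_curve_rotate[OF w(1), of k] by simp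
  then have "homotopic_curves T w v" using homotopic_rotate[OF w(1)] homotopic_curves.trans by blast
  then have "length w \<le> length v" using w(2) by (simp add: minimal_crossings_def)
  moreover have "length w = length v + 2" using arg_cong[OF v, of length] by simp
  ultimately show False by simp
qed

lemma transport_append: "transport T (w @ [s]) u \<longleftrightarrow> transport T w u \<noteq> twisted T (edge T s)"
  by (simp add: transport_def)

lemma transport_flip: "transport T w (\<not> u) \<longleftrightarrow> \<not> transport T w u"
proof (induction w rule: rev_induct)
  case (snoc s w)
  then show ?case by (auto simp: transport_append)
qed (simp add: transport_def)

lemma one_sided_transport: "one_sided T w \<Longrightarrow> transport T w u \<longleftrightarrow> \<not> u"
  using transport_flip[of T w True] by (cases u) (auto simp: one_sided_def)

lemma third_side_eq:
  assumes "triangulated_surface T" "p \<in> sides T" "q = cw T p \<or> q = ccw T p"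
  shows "third_side T p q = (if q = ccw T p then cw T p else ccw T p)"
proof -
  let ?r = "if q = ccw T p then cw T p else ccw T p"
  note distinct = sides_distinct[OF assms(1,2)]
  have "r = ?r" if "triangle T p = {p, q, r}" for r
  proof -
    have "?r \<in> {p, q, r}" unfolding that[symmetric] by (simp add: triangle_def)
    then show ?thesis using assms(3) distinct by auto
  qed
  moreover have "triangle T p = {p, q, ?r}" using assms(3) distinct by (auto simp: triangle_def)
  ultimately show ?thesis unfolding third_side_def by (intro the_equality) auto
qed

section \<open>The matrix product along a one-sided curve\<close>

locale one_sided_curve = laminated_surface T L
  for T :: "('s, 'e) triangulation" and L :: "'e \<Rightarrow> 's lift_side" +
  fixes w :: "'s list"
  assumes curve: "closed_curve T w" "w \<noteq> []" and one_sided: "one_sided T w"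
    and reduced: "\<And>k. k < length w \<Longrightarrow> w ! (Suc k mod length w) \<noteq> partner T (w ! k)"
begin

abbreviation d :: nat where "d \<equiv> length w"

abbreviation x :: "nat \<Rightarrow> 'e laurent" where "x j \<equiv> xvar (crossed_arc T w j)"

definition K :: "nat \<Rightarrow> 'e laurent^2^2" where
  "K j = crossing_matrix (crossing w j, curve_orientation T w j)"

definition Q :: "nat \<Rightarrow> 'e laurent^2^2" where
  "Q j = turn_matrix (CCW_transition T w j) (crossed_arc T w j) (passed_edge T w j) (crossed_arc T w (Suc j))"

lemma d_pos: "0 < d"
  using curve by simp

lemma inner_crossing: "j \<in> {1..d} \<Longrightarrow> inner T (crossing w j)"
  using curve by (auto simp: closed_curve_def crossing_def)

lemma partner_crossing_side: "j \<in> {1..d} \<Longrightarrow> partner T (crossing w j) \<in> sides T"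
  by (intro partner_side[OF T(1)] inner_crossing)

lemma edge_partner_crossing: "j \<in> {1..d} \<Longrightarrow> edge T (partner T (crossing w j)) = crossed_arc T w j"
  by (simp add: crossed_arc_def edge_partner[OF T(1) inner_crossing])

lemma crossing_d: "crossing w d = last w"
  using curve(2) by (simp add: crossing_def last_conv_nth)

lemma crossing_triangle:
  assumes "k < d"
  shows "w ! (Suc k mod d) = cw T (partner T (w ! k)) \<or> w ! (Suc k mod d) = ccw T (partner T (w ! k))"
  using curve(1) reduced[OF assms] assms unfolding closed_curve_def triangle_def by blast

lemma next_crossing:
  assumes "j \<in> {1..<d}"
  shows "crossing w (Suc j) = cw T (partner T (crossing w j)) \<or> crossing w (Suc j) = ccw T (partner T (crossing w j))"
  using crossing_triangle[of "j - 1"] assms by (auto simp: crossing_def)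

lemma first_crossing:
  "crossing w 1 = cw T (partner T (crossing w d)) \<or> crossing w 1 = ccw T (partner T (crossing w d))"
  using crossing_triangle[of "d - 1"] d_pos by (auto simp: crossing_def)

lemma curve_orientation_Suc:
  assumes "j \<in> {1..d}"
  shows "curve_orientation T w (Suc j) \<longleftrightarrow>
    curve_orientation T w j \<noteq> twisted T (edge T (crossing w j))"
proof -
  have "take j w = take (j - 1) w @ [crossing w j]"
    using assms take_Suc_conv_app_nth[of "j - 1" w] by (cases j) (simp_all add: crossing_def)
  then show ?thesis by (simp add: curve_orientation_def transport_append)
qed

lemma curve_orientation_1: "curve_orientation T w 1 \<longleftrightarrow> crossing w 1 = cw T (partner T (crossing w d))"
  by (simp add: curve_orientation_def transport_def)

lemma curve_orientation_end: "curve_orientation T w (Suc d) \<longleftrightarrow> \<not> curve_orientation T w 1"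
  using one_sided_transport[OF one_sided] by (simp add: curve_orientation_def transport_def[of T "[]"])

lemma CCW_transition_iff:
  assumes "j \<in> {1..<d}"
  shows "CCW_transition T w j \<longleftrightarrow>
    (crossing w (Suc j) = ccw T (partner T (crossing w j))) = curve_orientation T w (Suc j)"
proof -
  let ?p = "partner T (crossing w j)"
  have p: "?p \<in> sides T" using partner_crossing_side assms by simp
  show ?thesis
    using next_crossing[OF assms] third_side_eq[OF T(1) p next_crossing[OF assms]] sides_distinct[OF T(1) p]
      cw_cw[OF T(1) p] ccw_ccw[OF T(1) p]
    by (auto simp: CCW_transition_def Let_def)
qed

lemma passed_edge_eq:
  assumes "j \<in> {1..<d}"
  shows "passed_edge T w j = edge T (if crossing w (Suc j) = ccw T (partner T (crossing w j))
    then cw T (partner T (crossing w j)) else ccw T (partner T (crossing w j)))"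
  using third_side_eq[OF T(1) partner_crossing_side next_crossing[OF assms]] assms
  by (simp add: passed_edge_def)

lemma curve_step:
  assumes "j \<in> {1..<d}"
  shows "normalizer (curve_orientation T w (Suc (Suc j))) (crossed_arc T w (Suc j)) **
      cross_transfer (partner T (crossing w j)) (crossing w (Suc j)) ** scalar_matrix (x j) =\<^sub>\<plusminus>
    K (Suc j) ** Q j ** normalizer (curve_orientation T w (Suc j)) (crossed_arc T w j)"
proof -
  have j: "j \<in> {1..d}" "Suc j \<in> {1..d}" using assms by auto
  have eqs: "edge T (partner T (crossing w j)) = crossed_arc T w j"
    "edge T (crossing w (Suc j)) = crossed_arc T w (Suc j)"
    "(curve_orientation T w (Suc j) \<noteq> twisted T (crossed_arc T w (Suc j))) =
      curve_orientation T w (Suc (Suc j))"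
    using edge_partner_crossing[OF j(1)] curve_orientation_Suc[OF j(2)] by (auto simp: crossed_arc_def)
  show ?thesis
    using cross_transfer_normal[OF partner_crossing_side[OF j(1)] inner_crossing[OF j(2)] next_crossing[OF assms],
      of "curve_orientation T w (Suc j)"]
    unfolding eqs K_def Q_def CCW_transition_iff[OF assms] passed_edge_eq[OF assms] .
qed

lemma first_step:
  "normalizer (curve_orientation T w (Suc 1)) (crossed_arc T w 1) **
      cross_transfer (partner T (last w)) (crossing w 1) ** scalar_matrix (x d) =\<^sub>\<plusminus>
    K 1 ** mat2 (x 1) (xvar (cut_edge T w)) 0 (x d) ** normalizer (curve_orientation T w 1) (crossed_arc T w d)"
proof -
  let ?p = "partner T (crossing w d)"
  have j: "d \<in> {1..d}" "1 \<in> {1..d}" using d_pos by (simp_all add: Suc_le_eq)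
  note p = partner_crossing_side[OF j(1)]
  \<comment> \<open>The starting orientation is chosen so that the turn in the initial triangle has
    a fixed direction, hence the value \<open>False\<close> and always the upper triangular
    shape.\<close>
  have eqs: "edge T ?p = crossed_arc T w d" "edge T (crossing w 1) = crossed_arc T w 1"
    "(curve_orientation T w 1 \<noteq> twisted T (crossed_arc T w 1)) = curve_orientation T w (Suc 1)"
    "((crossing w 1 = ccw T ?p) = curve_orientation T w 1) = False"
    "edge T (if crossing w 1 = ccw T ?p then cw T ?p else ccw T ?p) = cut_edge T w"
    using edge_partner_crossing[OF j(1)] curve_orientation_Suc[OF j(2)] curve_orientation_1 first_crossing
      sides_distinct[OF T(1) p] third_side_eq[OF T(1) p first_crossing]
    by (auto simp: crossed_arc_def cut_edge_def)
  show ?thesis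
    using cross_transfer_normal[OF p inner_crossing[OF j(2)] first_crossing, of "curve_orientation T w 1"]
    unfolding eqs K_def by (simp add: turn_matrix_def crossing_d)
qed

text \<open>Each transition costs the variable of the side by which its triangle is entered. The
  first triangle is entered by the last crossing, whence the factor \<open>x d\<close>; at
  \<open>n = d - 1\<close> the full crossing monomial is reached.\<close>

lemma transfer_walk:
  assumes "n < d"
  shows "normalizer (curve_orientation T w (Suc (Suc n))) (crossed_arc T w (Suc n)) **
      transfer (partner T (last w)) (take (Suc n) w) ** scalar_matrix (x d * (\<Prod>i\<in>{1..n}. x i)) =\<^sub>\<plusminus>
    walk_matrix K Q n ** (mat2 (x 1) (xvar (cut_edge T w)) 0 (x d) **
      normalizer (curve_orientation T w 1) (crossed_arc T w d))"
  using assms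
proof (induction n)
  case 0
  have "take (Suc 0) w = [crossing w 1]" using curve(2) by (cases w) (auto simp: crossing_def)
  then show ?case using first_step by (simp add: matrix_mul_lid matrix_mul_assoc)
next
  case (Suc n)
  let ?N = "\<lambda>j. normalizer (curve_orientation T w (Suc j)) (crossed_arc T w j)"
  let ?p = "partner T (last w)" and ?s = "crossing w (Suc (Suc n))" and ?c = "x d * (\<Prod>i\<in>{1..n}. x i)"
  let ?X = "cross_transfer (partner T (crossing w (Suc n))) ?s"
  have j: "Suc n \<in> {1..<d}" using Suc.prems by simp
  have "take (Suc (Suc n)) w = take (Suc n) w @ [?s]"
    using Suc.prems by (simp add: take_Suc_conv_app_nth crossing_def)
  moreover have "last_partner ?p (take (Suc n) w) = partner T (crossing w (Suc n))"
    using Suc.prems curve(2) by (simp add: last_partner_def crossing_def take_Suc_conv_app_nth)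
  ultimately have transfer: "transfer ?p (take (Suc (Suc n)) w) = ?X ** transfer ?p (take (Suc n) w)"
    by (simp add: transfer_append)
  have "?N (Suc (Suc n)) ** transfer ?p (take (Suc (Suc n)) w) ** scalar_matrix (x d * (\<Prod>i\<in>{1..Suc n}. x i)) =
      ?N (Suc (Suc n)) ** ?X ** (transfer ?p (take (Suc n) w) ** scalar_matrix (x (Suc n))) ** scalar_matrix ?c"
    unfolding transfer by (simp add: matrix_mul_assoc[symmetric] scalar_matrix_mult mult_ac)
  also have "\<dots> = ?N (Suc (Suc n)) ** ?X ** scalar_matrix (x (Suc n)) ** (transfer ?p (take (Suc n) w) ** scalar_matrix ?c)"
    by (simp add: scalar_matrix_commute[of "transfer ?p (take (Suc n) w)" "x (Suc n)"] matrix_mul_assoc)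
  also have "\<dots> =\<^sub>\<plusminus> K (Suc (Suc n)) ** Q (Suc n) ** ?N (Suc n) ** (transfer ?p (take (Suc n) w) ** scalar_matrix ?c)"
    by (rule eq_sign_matrix_mult[OF curve_step[OF j] eq_sign_refl])
  also have "\<dots> = K (Suc (Suc n)) ** Q (Suc n) ** (?N (Suc n) ** transfer ?p (take (Suc n) w) ** scalar_matrix ?c)"
    by (simp add: matrix_mul_assoc)
  also have "\<dots> =\<^sub>\<plusminus> K (Suc (Suc n)) ** Q (Suc n) ** (walk_matrix K Q n **
      (mat2 (x 1) (xvar (cut_edge T w)) 0 (x d) ** normalizer (curve_orientation T w 1) (crossed_arc T w d)))"
    using Suc.IH Suc.prems by (intro eq_sign_matrix_mult[OF eq_sign_refl]) simp
  finally show ?case by (simp add: matrix_mul_assoc)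
qed

lemma trace_transfer_walk:
  "(\<Prod>i\<in>{1..d}. x i) * trace (transfer (partner T (last w)) w) =\<^sub>\<plusminus>
    trace (walk_matrix K Q (d - 1) ** mat2 (xvar (cut_edge T w)) (x 1) (x d) 0)"
proof -
  let ?u = "curve_orientation T w 1" and ?e = "crossed_arc T w d" and ?M = "mat2 (x 1) (xvar (cut_edge T w)) 0 (x d)"
  let ?T = "transfer (partner T (last w)) w" and ?c = "\<Prod>i\<in>{1..d}. x i" and ?W = "walk_matrix K Q (d - 1)"
  have d: "Suc (d - 1) = d" using d_pos by simp
  have c: "x d * (\<Prod>i\<in>{1..d - 1}. x i) = ?c"
    using prod.nat_ivl_Suc'[of 1 "d - 1" "\<lambda>i. x i"] unfolding d using d_pos by simp
  have walk: "normalizer (\<not> ?u) ?e ** ?T ** scalar_matrix ?c =\<^sub>\<plusminus> ?W ** (?M ** normalizer ?u ?e)"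
    using transfer_walk[of "d - 1"] d_pos unfolding d c curve_orientation_end by simp
  have "scalar_matrix ?c ** ?T = normalizer_inv (\<not> ?u) ?e ** (normalizer (\<not> ?u) ?e ** ?T ** scalar_matrix ?c)"
    by (simp add: matrix_mul_assoc normalizer_normalizer_inv matrix_mul_lid scalar_matrix_commute[of ?T])
  then have "?c * trace ?T = trace (normalizer_inv (\<not> ?u) ?e ** (normalizer (\<not> ?u) ?e ** ?T ** scalar_matrix ?c))"
    by (simp only: trace_scalar[symmetric])
  also have "\<dots> =\<^sub>\<plusminus> trace (normalizer_inv (\<not> ?u) ?e ** (?W ** (?M ** normalizer ?u ?e)))"
    by (rule eq_sign_trace[OF eq_sign_matrix_mult[OF eq_sign_refl walk]])
  \<comment> \<open>Cyclic invariance brings the two normalizers together. They belong to opposite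
    orientations, so their product is antidiagonal instead of the identity.\<close>
  also have "\<dots> = trace (?W ** (?M ** normalizer ?u ?e) ** normalizer_inv (\<not> ?u) ?e)"
    by (rule trace_mul_sym)
  also have "\<dots> = trace (?W ** (?M ** (normalizer ?u ?e ** normalizer_inv (\<not> ?u) ?e)))"
    by (simp only: matrix_mul_assoc)
  also have "\<dots> = trace (?W ** (- mat2 (xvar (cut_edge T w)) (x 1) (x d) 0))"
    by (simp add: normalizer_normalizer_inv)
  also have "\<dots> =\<^sub>\<plusminus> trace (?W ** mat2 (xvar (cut_edge T w)) (x 1) (x d) 0)"
    by (rule eq_sign_trace) (simp add: eq_sign_def matrix_mult_uminus del: mat2_uminus)
  finally show ?thesis .
qed

end

section \<open>The expansion formula\<close>

context one_sided_curve
begin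

text \<open>
  Matchings are encoded by the set \<open>C\<close> of tiles at which the transfer matrix product passes through its first
  coordinate.  The parity accounts for the tiles being reflected alternately.
\<close>

definition up_set :: "nat set \<Rightarrow> nat \<Rightarrow> bool" where
  "up_set C i \<longleftrightarrow> (i \<in> C) = odd i"

abbreviation A :: "nat \<Rightarrow> bool" where "A \<equiv> glued_above T w"

abbreviation matching :: "nat set \<Rightarrow> tile_edge set" where
  "matching C \<equiv> matching_of d A (up_set C)"

definition good_sets :: "nat set set" where
  "good_sets = {C \<in> Pow {1..d}. admissible d A (up_set C) \<and> (1 \<in> C \<or> d \<in> C)}"

lemma glued_above_iff: "A i \<longleftrightarrow> CCW_transition T w i = odd i"
  by (auto simp: glued_above_def)

lemma first_cut_mem: "admissible d A (up_set C) \<Longrightarrow> first_cut \<in> matching C \<longleftrightarrow> 1 \<in> C"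
  using mem_matching_of_iff[OF d_pos, of A "up_set C" first_cut] d_pos
  by (simp add: first_cut_def level_edge_def up_set_def)

text \<open>The edge on the last level is North exactly when \<open>(d \<in> C) = odd d\<close>, and
  a' is North exactly for odd \<open>d\<close>; the parities cancel.\<close>

lemma last_cut_mem: "admissible d A (up_set C) \<Longrightarrow> last_cut w \<in> matching C \<longleftrightarrow> d \<in> C"
  using mem_matching_of_iff[OF d_pos, of A "up_set C" "last_cut w"] d_pos
  by (auto simp: last_cut_def level_edge_def up_set_def)

lemma bij_good_matchings: "bij_betw matching good_sets (good_matchings T w)"
  unfolding bij_betw_def
proof
  show "inj_on matching good_sets"
  proof (rule inj_onI)
    fix C C' assume CC': "C \<in> good_sets" "C' \<in> good_sets" "matching C = matching C'"
    then have "up_set C i = up_set C' i" if "i \<in> {1..d}" for i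
      using matching_of_inj[OF d_pos _ _ CC'(3) that] by (simp add: good_sets_def)
    then have "i \<in> C \<longleftrightarrow> i \<in> C'" if "i \<in> {1..d}" for i
      using that unfolding up_set_def by blast
    then show "C = C'" using CC'(1,2) by (auto simp: good_sets_def)
  qed
  show "matching ` good_sets = good_matchings T w"
  proof
    show "matching ` good_sets \<subseteq> good_matchings T w"
      using matching_of_perfect[OF d_pos] first_cut_mem last_cut_mem
      by (auto simp: good_sets_def good_matchings_def)
    show "good_matchings T w \<subseteq> matching ` good_sets"
    proof
      fix P assume P: "P \<in> good_matchings T w"
      then obtain c where c: "admissible d A c" "P = matching_of d A c"
        using perfect_matching_is_matching_of[OF d_pos] by (auto simp: good_matchings_def)
      define C where "C = {i \<in> {1..d}. c i = odd i}"
      have up: "up_set C i = c i" if "i \<in> {1..d}" for i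
        using that by (auto simp: up_set_def C_def)
      have adm: "admissible d A (up_set C)" using c(1) up by (auto simp: admissible_def)
      have "P = matching C"
        unfolding c(2) matching_of_def using level_edge_cong[of d "up_set C" c] up d_pos
        by (intro image_cong) auto
      moreover have "C \<in> good_sets"
        using P adm first_cut_mem[OF adm] last_cut_mem[OF adm] \<open>P = matching C\<close>
        by (auto simp: good_sets_def good_matchings_def C_def)
      ultimately show "P \<in> matching ` good_sets" by blast
    qed
  qed
qed

lemma Q_admissible:
  assumes "i \<in> {1..<d}" "admissible d A (up_set C)"
  shows "Q i $ mat2_index (Suc i \<in> C) $ mat2_index (i \<in> C) =
    xvar (edge_label T w (level_edge d A (up_set C) i))"
proof -
  have "up_set C i = A i \<or> up_set C (Suc i) = A i" using assms by (simp add: admissible_def)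
  then show ?thesis
    using assms(1) glued_above_iff[of i]
    by (cases "i \<in> C"; cases "Suc i \<in> C"; cases "CCW_transition T w i"; cases "odd i")
      (simp_all add: Q_def turn_matrix_def level_edge_def up_set_def)
qed

text \<open>Violating admissibility means choosing the two vertices that no edge joins, where
  \<open>turn_matrix\<close> has its 0.\<close>

lemma Q_not_admissible:
  assumes "\<not> admissible d A (up_set C)"
  shows "\<exists>i\<in>{1..<d}. Q i $ mat2_index (Suc i \<in> C) $ mat2_index (i \<in> C) = 0"
proof -
  obtain i where i: "i \<in> {1..<d}" "up_set C i \<noteq> A i" "up_set C (Suc i) \<noteq> A i"
    using assms unfolding admissible_def by blast
  have "Q i $ mat2_index (Suc i \<in> C) $ mat2_index (i \<in> C) = 0"
    using i(2,3) glued_above_iff[of i]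
    by (cases "i \<in> C"; cases "Suc i \<in> C"; cases "CCW_transition T w i"; cases "odd i")
      (simp_all add: Q_def turn_matrix_def up_set_def)
  then show ?thesis using i(1) by blast
qed

text \<open>Joint weight of the two end levels after the deletion: \<open>s\<close> and
  \<open>e\<close> tell whether the matching contains a and a'. If both, one copy of x_a remains; if
  only a, the last edge has label i_1; if only a', the first edge has label i_d; if neither, the
  matching is not good.\<close>

definition cut_weight :: "bool \<Rightarrow> bool \<Rightarrow> 'e laurent" where
  "cut_weight s e = mat2 (xvar (cut_edge T w)) (x 1) (x d) 0 $ mat2_index s $ mat2_index e"

definition crossing_weight :: "nat \<Rightarrow> bool \<Rightarrow> 'e laurent" where
  "crossing_weight j b = K j $ mat2_index b $ mat2_index b"

lemma K_diagonal: "K j = mat2 (crossing_weight j True) 0 0 (crossing_weight j False)"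
  by (simp add: crossing_weight_def K_def crossing_matrix_def)

lemma x_weight_matching:
  assumes C: "C \<in> good_sets"
  shows "x_weight T w (matching C) =
    cut_weight (1 \<in> C) (d \<in> C) * (\<Prod>i\<in>{1..<d}. Q i $ mat2_index (Suc i \<in> C) $ mat2_index (i \<in> C))"
proof -
  let ?e = "level_edge d A (up_set C)"
  have adm: "admissible d A (up_set C)" and C1: "1 \<in> C \<or> d \<in> C" using C by (auto simp: good_sets_def)
  \<comment> \<open>The level of the deleted edge: if both cut edges are present, a is deleted, as
    in \<open>remaining_edges\<close>. The opposite end level is \<open>d - k\<close>.\<close>
  define k where "k = (if 1 \<in> C then 0 else d)"
  have inj: "inj_on ?e {0..d}"
    using level_level_edge[OF d_pos _ adm] by (auto intro!: inj_on_inverseI[of _ level])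
  have cut: "?e k = (if 1 \<in> C then first_cut else last_cut w)"
    using C1 d_pos by (auto simp: k_def level_edge_def first_cut_def last_cut_def up_set_def)
  have "remaining_edges w (matching C) = ?e ` {0..d} - {?e k}"
    unfolding remaining_edges_def cut first_cut_mem[OF adm] unfolding matching_of_def ..
  also have "\<dots> = ?e ` ({0..d} - {k})"
    using inj_on_image_set_diff[OF inj, of "{0..d}" "{k}"] by (simp add: k_def)
  finally have "x_weight T w (matching C) = (\<Prod>i\<in>{0..d} - {k}. xvar (edge_label T w (?e i)))"
    unfolding x_weight_def by (simp add: prod.reindex[OF inj_on_subset[OF inj]])
  also have "{0..d} - {k} = insert (d - k) {1..<d}"
    using d_pos by (auto simp: k_def)
  also have "(\<Prod>i\<in>insert (d - k) {1..<d}. xvar (edge_label T w (?e i))) =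
      xvar (edge_label T w (?e (d - k))) * (\<Prod>i\<in>{1..<d}. xvar (edge_label T w (?e i)))"
    using d_pos by (subst prod.insert) (auto simp: k_def)
  also have "xvar (edge_label T w (?e (d - k))) = cut_weight (1 \<in> C) (d \<in> C)"
    using C1 d_pos
    by (cases "1 \<in> C"; cases "d \<in> C"; cases "odd d")
      (simp_all add: k_def level_edge_def up_set_def cut_weight_def)
  also have "(\<Prod>i\<in>{1..<d}. xvar (edge_label T w (?e i))) =
      (\<Prod>i\<in>{1..<d}. Q i $ mat2_index (Suc i \<in> C) $ mat2_index (i \<in> C))"
    using Q_admissible[OF _ adm] by (intro prod.cong) auto
  finally show ?thesis .
qed

text \<open>The parity in the notion of an oriented diagonal cancels the one in
  \<open>up_set\<close>: at a positive crossing tile \<open>j\<close> contributes its variable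
  exactly when \<open>j \<notin> C\<close>, at a negative one exactly when
  \<open>j \<in> C\<close>.\<close>

lemma y_weight_matching:
  assumes C: "C \<in> good_sets"
  shows "y_weight T L w (matching C) = (\<Prod>j\<in>{1..d}. crossing_weight j (j \<in> C))"
proof -
  have adm: "admissible d A (up_set C)" using C by (auto simp: good_sets_def)
  have "(if L_oriented T L w (matching C) j then yvar (crossed_arc T w j) else 1) =
      crossing_weight j (j \<in> C)" if j: "j \<in> {1..d}" for j
  proof -
    have "crossing_sign T L w j = 1 \<or> crossing_sign T L w j = -1"
      using shear_values[OF T L inner_crossing[OF j]] by (simp add: crossing_sign_def)
    moreover have "positive_crossing (crossing w j, curve_orientation T w j) \<longleftrightarrow> crossing_sign T L w j = 1"
      by (simp add: positive_crossing_def crossing_sign_def)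
    ultimately show ?thesis
      by (cases "j \<in> C"; cases "odd j")
        (auto simp: crossing_weight_def K_def crossing_matrix_def L_oriented_def Let_def up_set_def
          diagonal_up_matching_of[OF d_pos adm j] crossed_arc_def)
  qed
  then have "(\<Prod>j\<in>{1..d}. if L_oriented T L w (matching C) j then yvar (crossed_arc T w j) else 1) =
      (\<Prod>j\<in>{1..d}. crossing_weight j (j \<in> C))"
    by (rule prod.cong[OF HOL.refl])
  then show ?thesis unfolding y_weight_def by (subst prod.inter_filter) simp_all
qed

lemma sum_good_matchings:
  "(\<Sum>P\<in>good_matchings T w. x_weight T w P * y_weight T L w P) =
    trace (walk_matrix K Q (d - 1) ** mat2 (xvar (cut_edge T w)) (x 1) (x d) 0)"
proof -
  have d: "Suc (d - 1) = d" "{1..d - 1} = {1..<d}" using d_pos by auto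
  let ?f = "\<lambda>C. cut_weight (1 \<in> C) (d \<in> C) *
    ((\<Prod>i\<in>{1..<d}. Q i $ mat2_index (Suc i \<in> C) $ mat2_index (i \<in> C)) *
     (\<Prod>j\<in>{1..d}. crossing_weight j (j \<in> C)))"
  have "(\<Sum>P\<in>good_matchings T w. x_weight T w P * y_weight T L w P) =
      (\<Sum>C\<in>good_sets. x_weight T w (matching C) * y_weight T L w (matching C))"
    by (rule sum.reindex_bij_betw[OF bij_good_matchings, symmetric])
  also have "\<dots> = (\<Sum>C\<in>good_sets. ?f C)"
    by (intro sum.cong) (simp_all add: x_weight_matching y_weight_matching mult.assoc)
  \<comment> \<open>The sum extends to all subsets since the other terms vanish: inadmissible sets
    meet a 0 of some \<open>Q i\<close>, and sets with neither end meet the 0 of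
    \<open>cut_weight\<close>.\<close>
  also have "\<dots> = (\<Sum>C\<in>Pow {1..d}. ?f C)"
  proof (rule sum.mono_neutral_left)
    show "\<forall>C\<in>Pow {1..d} - good_sets. ?f C = 0"
    proof
      fix C assume C: "C \<in> Pow {1..d} - good_sets"
      then consider "\<not> admissible d A (up_set C)" | "1 \<notin> C" "d \<notin> C" by (auto simp: good_sets_def)
      then show "?f C = 0"
      proof cases
        case 1
        then have "(\<Prod>i\<in>{1..<d}. Q i $ mat2_index (Suc i \<in> C) $ mat2_index (i \<in> C)) = 0"
          using Q_not_admissible by (intro prod_zero) auto
        then show ?thesis by (simp only: mult_zero_left mult_zero_right)
      next
        case 2
        then show ?thesis by (simp add: cut_weight_def)
      qed
    qed
  qed (auto simp: good_sets_def)
  also have "\<dots> = (\<Sum>s\<in>UNIV. \<Sum>e\<in>UNIV. cut_weight s e * walk_matrix K Q (d - 1) $ mat2_index e $ mat2_index s)"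
    using walk_matrix_sum[of K crossing_weight cut_weight "d - 1" Q, OF K_diagonal] unfolding d .
  also have "\<dots> = trace (walk_matrix K Q (d - 1) ** mat2 (xvar (cut_edge T w)) (x 1) (x d) 0)"
    by (simp add: UNIV_bool cut_weight_def trace_entries matrix_mult_entry algebra_simps)
  finally show ?thesis .
qed

lemma laurent_monomial_weights: "laurent_monomial (x_weight T w P * y_weight T L w P)"
  unfolding x_weight_def y_weight_def
  by (intro laurent_monomial_mult laurent_monomial_prod laurent_monomial_vars)

lemma trace_transfer_expansion:
  "trace (transfer (partner T (last w)) w) =\<^sub>\<plusminus>
    inverse_cross_monomial T w * (\<Sum>P\<in>good_matchings T w. x_weight T w P * y_weight T L w P)"
proof -
  have "inverse_cross_monomial T w * (\<Prod>i\<in>{1..d}. x i) = 1"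
    by (simp add: inverse_cross_monomial_def xvar_xinv flip: prod.distrib)
  then have "trace (transfer (partner T (last w)) w) =
      inverse_cross_monomial T w * ((\<Prod>i\<in>{1..d}. x i) * trace (transfer (partner T (last w)) w))"
    by (simp flip: mult.assoc)
  then show ?thesis
    using trace_transfer_walk unfolding sum_good_matchings[symmetric] by (auto simp: eq_sign_def)
qed

lemma nonneg_expansion:
  "nonneg_laurent (inverse_cross_monomial T w *
    (\<Sum>P\<in>good_matchings T w. x_weight T w P * y_weight T L w P))"
  unfolding sum_distrib_left inverse_cross_monomial_def
  by (intro nonneg_laurent_sum laurent_monomial_mult[OF _ laurent_monomial_weights] laurent_monomial_prod
      laurent_monomial_vars)

end

theorem theorem6p8:
  fixes T :: "('s, 'e) triangulation"
    and L :: "'e \<Rightarrow> 's lift_side"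
    and om :: "'s flag \<Rightarrow> bool"
    and \<alpha> :: "'s list"
  assumes "triangulated_surface T" and "unpunctured T" and "\<not> orientable T"
    and "principal_lamination T L"
    and "point_orientations T om"
    and "closed_curve T \<alpha>" and "minimal_crossings T \<alpha>"
    and "one_sided T \<alpha>"
    and "\<not> contractible_curve T \<alpha>"
    and "\<not> contractible_kink T \<alpha>"
  shows "chi T L om \<alpha> =
    inverse_cross_monomial T \<alpha> * (\<Sum>P\<in>good_matchings T \<alpha>. x_weight T \<alpha> P * y_weight T L \<alpha> P)"
proof -
  \<comment> \<open>The empty sequence preserves orientation, so it is not one-sided.\<close>
  have ne: "\<alpha> \<noteq> []" using assms(8) by (auto simp: one_sided_def transport_def)
  interpret oriented_laminated_surface T L om
    by unfold_locales (use assms in auto)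
  interpret one_sided_curve T L \<alpha>
    by unfold_locales (use assms ne minimal_crossings_reduced in auto)
  let ?S = "inverse_cross_monomial T \<alpha> * (\<Sum>P\<in>good_matchings T \<alpha>. x_weight T \<alpha> P * y_weight T L \<alpha> P)"
  have sign: "positive_sign (trace (path_matrix T L om (fst \<rho>) (snd \<rho>))) = ?S" if "M_path T \<alpha> \<rho>" for \<rho>
  proof (rule positive_sign_eq[OF _ nonneg_expansion])
    show "trace (path_matrix T L om (fst \<rho>) (snd \<rho>)) =\<^sub>\<plusminus> ?S"
      using M_path_trace[OF curve, of "fst \<rho>" "snd \<rho>"] that trace_transfer_expansion eq_sign_trans by auto
  qed
  \<comment> \<open>All paths give the same value, but the definite description in
    \<open>chi\<close> also requires that one exists.\<close>
  obtain \<rho> where \<rho>: "M_path T \<alpha> \<rho>" using M_path_exists[OF curve] by blast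
  show ?thesis
    unfolding chi_def
  proof (rule the_equality)
    show "\<exists>\<rho>. M_path T \<alpha> \<rho> \<and> ?S = positive_sign (trace (path_matrix T L om (fst \<rho>) (snd \<rho>)))"
      using \<rho> sign[OF \<rho>] by (intro exI[of _ \<rho>]) simp
  next
    fix c assume "\<exists>\<rho>. M_path T \<alpha> \<rho> \<and> c = positive_sign (trace (path_matrix T L om (fst \<rho>) (snd \<rho>)))"
    then show "c = ?S" using sign by auto
  qed
qed

end
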